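(* Let $\lambda_1,\lambda_2,C\in\mathbb{R}\setminus\{0\}$ and $a\in\mathbb{R}\setminus\{0\}$, let $I\subset\mathbb{R}$ be an open interval, and let $\alpha:I\to\mathbb{R}$ (or $\mathbb{R}/2\pi\mathbb{Z}$), $z:I\to\mathbb{R}$ and $w_1,w_2:I\to\mathbb{C}\setminus\{0\}$ be smooth. Write $w_j=r_j(s)e^{i\phi_j(s)}$ with $r_j=|w_j|:I\to(0,\infty)$, and $\phi=\phi_1+\phi_2$, where $\phi_1,\phi_2,\phi:I\to\mathbb{R}$ (or $\mathbb{R}/2\pi\mathbb{Z}$). Fix $s_0\in I$, put $\rho_j=r_j^2(s_0)$, and define $$u(s)=2\int_{s_0}^{s}r_1(t)r_2(t)\cos(\alpha(t)+\phi(t))\,dt,\qquad Q(u)=\prod_{j=1}^{2}(\rho_j+\lambda_j u).$$ Suppose that on $I$ $$\frac{dw_1}{ds}=\lambda_1e^{-i\alpha(s)}\overline{w}_2,\qquad \frac{dw_2}{ds}=\lambda_2e^{-i\alpha(s)}\overline{w}_1,$$ $$\frac{d\phi_j}{ds}=-\frac{\lambda_j}{\rho_j+\lambda_ju}Q(u)^{1/2}\sin(\alpha+\phi)\quad(j=1,2),\qquad \frac{dz}{ds}=\frac{C}{2}Q(u)^{1/2}\sin(\alpha+\phi).$$ Then $r_j^2(s)=\rho_j+\lambda_ju(s)$ for $j=1,2$ and $s\in I$, and the submanifold $$\tilde L=\Big\{(x_1w_1(s),x_2w_2(s),z(s)):\ s\in I,\ x_j\in\mathbb{R},\ \sum_{j=1}^{2}\lambda_jx_j^2=C\Big\}\subset\mathbb{C}^2\times\mathbb{R}$$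 is Legendrian. Furthermore, if $$\frac{d\alpha}{ds}=-\frac{a}{4}\,C\,r_1r_2\sin(\alpha+\phi)\quad\text{on } I,$$ then $\tilde L$ satisfies $$H-2\alpha\xi=aX^{\perp}$$ and is a self-similar solution to the Legendrian mean curvature flow.
   Context: $\mathbb{R}^5=\mathbb{C}^2\times\mathbb{R}$ has coordinates $(x_1,y_1,x_2,y_2,z)$, $z_j=x_j+iy_j$, and carries the contact form $\eta=\frac12dz-\frac14\sum_{i=1}^2(y_i\,dx_i-x_i\,dy_i)$, the Riemannian metric $g=\eta\otimes\eta+\frac14\sum_{i=1}^2(dx_i^2+dy_i^2)$, the Reeb field $\xi=2\partial_z$, and the $(1,1)$-tensor $\Phi$ given by $\Phi(\partial_{x_i})=-\partial_{y_i}+\frac{x_i}{2}\partial_z$, $\Phi(\partial_{y_i})=\partial_{x_i}+\frac{y_i}{2}\partial_z$, $\Phi(\partial_z)=0$. An immersed surface $F:L^2\to\mathbb{R}^5$ is Legendrian if $F^*\eta=0$. Its normal bundle is then $NL=\Phi TL\oplus\mathbb{R}\xi$; $H$ is its mean curvature vector (trace of the second fundamental form with respect to $g$). The Legendre angle $\alpha$ is normalized by $F^*\Omega^T=e^{-i\alpha}\mathrm{Vol}_L$, equivalently $H=\Phi\nabla\alpha$, where $\Omega^T=\frac14dz_1\wedge dz_2$ and $\mathrm{Vol}_L$ is the induced volume form. The vector field $X=\sum_i(x_i\partial_{x_i}+y_i\partial_{y_i})+2z\partial_z$ generates the contact dilations $\delta_\lambda(x,y,z)=(\lambda x,\lambda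 y,\lambda^2z)$, and $X^\perp$ is its projection onto $NL$. The Legendrian mean curvature flow is $\frac{d}{dt}F_t=H-2\alpha\xi$. A Legendrian immersion with $H-2\alpha\xi=aX^\perp$ for a constant $a$ is called a self-shrinker if $a<0$ and a self-expander if $a>0$; these are the self-similar solutions. In the definition of $\tilde L$, $x_1,x_2$ are real parameters, not ambient coordinates.
   Formalization: The equation H−2αξ=aX^⊥ and self-similarity are proved under the added condition α(s_0)+(a/2)z(s_0)=0, without which they fail (nonempty L̃); in general the equation is proved with α replaced by α−(α(s_0)+(a/2)z(s_0)). Angles are real-valued. *)

theory Defs
  imports "HOL-Analysis.Analysis"
begin

section \<open>Smooth maps\<close>

fun Ck_on :: "nat \<Rightarrow> 'a::real_normed_vector set \<Rightarrow> ('a \<Rightarrow> 'b::real_normed_vector) \<Rightarrow> bool" where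
  "Ck_on 0 S f \<longleftrightarrow> continuous_on S f"
| "Ck_on (Suc n) S f \<longleftrightarrow>
     (\<forall>x\<in>S. f differentiable (at x)) \<and>
     (\<forall>v. Ck_on n S (\<lambda>x. frechet_derivative f (at x) v))"

text \<open>Only meant for open \<open>S\<close>.\<close>

definition smooth_on :: "'a::real_normed_vector set \<Rightarrow> ('a \<Rightarrow> 'b::real_normed_vector) \<Rightarrow> bool" where
  "smooth_on S f \<longleftrightarrow> (\<forall>n. Ck_on n S f)"

section \<open>Surfaces and immersions\<close>

text \<open>The abstract surface is an embedded surface \<open>M\<close> in some Euclidean space (no loss of
  generality, by Whitney); a chart is an inverse coordinate system defined on an open subset of
  the plane. All notions for an immersion \<open>F\<close> on \<open>M\<close> are expressed through \<open>F \<circ> \<psi>\<close>,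
  for charts \<open>\<psi>\<close>.\<close>

definition surface_chart ::
    "'e::euclidean_space set \<Rightarrow> (real \<times> real) set \<Rightarrow> (real \<times> real \<Rightarrow> 'e) \<Rightarrow> bool" where
  "surface_chart M U \<psi> \<longleftrightarrow>
     open U \<and> smooth_on U \<psi> \<and> (\<forall>p\<in>U. inj (frechet_derivative \<psi> (at p))) \<and>
     \<psi> ` U \<subseteq> M \<and> openin (top_of_set M) (\<psi> ` U) \<and> (\<exists>h. homeomorphism U (\<psi> ` U) \<psi> h)"

definition embedded_surface :: "'e::euclidean_space set \<Rightarrow> bool" where
  "embedded_surface M \<longleftrightarrow> (\<forall>q\<in>M. \<exists>U \<psi>. surface_chart M U \<psi> \<and> q \<in> \<psi> ` U)"

definition immersed_surface ::
    "'e::euclidean_space set \<Rightarrow> ('e \<Rightarrow> 'a::euclidean_space) \<Rightarrow> bool" where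
  "immersed_surface M F \<longleftrightarrow> embedded_surface M \<and>
     (\<forall>U \<psi>. surface_chart M U \<psi> \<longrightarrow>
        smooth_on U (F \<circ> \<psi>) \<and> (\<forall>p\<in>U. inj (frechet_derivative (F \<circ> \<psi>) (at p))))"

section \<open>Riemannian geometry of parametrised surfaces\<close>

text \<open>A metric \<open>G\<close> on a Euclidean space assigns to a point \<open>p\<close> the inner product \<open>G p\<close>. The
  Christoffel map of its Levi-Civita connection is given by the Koszul formula for constant
  vector fields.\<close>

definition christoffel :: "('a \<Rightarrow> 'a \<Rightarrow> 'a \<Rightarrow> real) \<Rightarrow> 'a::euclidean_space \<Rightarrow> 'a \<Rightarrow> 'a \<Rightarrow> 'a" where
  "christoffel G p u v = (THE w. \<forall>e.
     G p w e = (frechet_derivative (\<lambda>x. G x v e) (at p) u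
              + frechet_derivative (\<lambda>x. G x u e) (at p) v
              - frechet_derivative (\<lambda>x. G x u v) (at p) e) / 2)"

text \<open>Covariant derivative along \<open>f\<close>, in direction \<open>u\<close>, of the field \<open>df(v)\<close>, for constant
  \<open>u\<close>, \<open>v\<close> in the parameter plane.\<close>

definition cov_deriv ::
    "('a \<Rightarrow> 'a \<Rightarrow> 'a \<Rightarrow> real) \<Rightarrow> (real \<times> real \<Rightarrow> 'a::euclidean_space)
      \<Rightarrow> real \<times> real \<Rightarrow> real \<times> real \<Rightarrow> real \<times> real \<Rightarrow> 'a" where
  "cov_deriv G f p u v =
     frechet_derivative (\<lambda>q. frechet_derivative f (at q) v) (at p) u
     + christoffel G (f p) (frechet_derivative f (at p) u) (frechet_derivative f (at p) v)"

text \<open>The \<open>G\<close>-orthogonal projection of a vector at \<open>f p\<close> onto the normal space of \<open>f\<close>.\<close>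

definition normal_part ::
    "('a \<Rightarrow> 'a \<Rightarrow> 'a \<Rightarrow> real) \<Rightarrow> (real \<times> real \<Rightarrow> 'a::euclidean_space)
      \<Rightarrow> real \<times> real \<Rightarrow> 'a \<Rightarrow> 'a" where
  "normal_part G f p Y = (THE n.
     (\<forall>v. G (f p) n (frechet_derivative f (at p) v) = 0) \<and>
     Y - n \<in> range (frechet_derivative f (at p)))"

definition second_ff ::
    "('a \<Rightarrow> 'a \<Rightarrow> 'a \<Rightarrow> real) \<Rightarrow> (real \<times> real \<Rightarrow> 'a::euclidean_space)
      \<Rightarrow> real \<times> real \<Rightarrow> real \<times> real \<Rightarrow> real \<times> real \<Rightarrow> 'a" where
  "second_ff G f p u v = normal_part G f p (cov_deriv G f p u v)"

definition first_ff ::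
    "('a \<Rightarrow> 'a \<Rightarrow> 'a \<Rightarrow> real) \<Rightarrow> (real \<times> real \<Rightarrow> 'a::euclidean_space)
      \<Rightarrow> real \<times> real \<Rightarrow> real \<times> real \<Rightarrow> real \<times> real \<Rightarrow> real" where
  "first_ff G f p u v = G (f p) (frechet_derivative f (at p) u) (frechet_derivative f (at p) v)"

definition gram_det ::
    "('a \<Rightarrow> 'a \<Rightarrow> 'a \<Rightarrow> real) \<Rightarrow> (real \<times> real \<Rightarrow> 'a::euclidean_space) \<Rightarrow> real \<times> real \<Rightarrow> real" where
  "gram_det G f p = first_ff G f p (1,0) (1,0) * first_ff G f p (0,1) (0,1)
                    - first_ff G f p (1,0) (0,1) * first_ff G f p (0,1) (1,0)"

text \<open>The trace of the second fundamental form (not divided by the dimension), with the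
  inverse of the two-by-two Gram matrix written out.\<close>

definition mean_curvature ::
    "('a \<Rightarrow> 'a \<Rightarrow> 'a \<Rightarrow> real) \<Rightarrow> (real \<times> real \<Rightarrow> 'a::euclidean_space) \<Rightarrow> real \<times> real \<Rightarrow> 'a" where
  "mean_curvature G f p = (1 / gram_det G f p) *\<^sub>R
     (first_ff G f p (0,1) (0,1) *\<^sub>R second_ff G f p (1,0) (1,0)
      - first_ff G f p (1,0) (0,1) *\<^sub>R second_ff G f p (1,0) (0,1)
      - first_ff G f p (0,1) (1,0) *\<^sub>R second_ff G f p (0,1) (1,0)
      + first_ff G f p (1,0) (1,0) *\<^sub>R second_ff G f p (0,1) (0,1))"

section \<open>The standard Sasakian structure on \<open>\<complex>\<^sup>2 \<times> \<real>\<close>\<close>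

type_synonym r5 = "complex \<times> complex \<times> real"

text \<open>\<open>\<eta> = dz/2 - (y\<^sub>1 dx\<^sub>1 - x\<^sub>1 dy\<^sub>1 + y\<^sub>2 dx\<^sub>2 - x\<^sub>2 dy\<^sub>2)/4\<close>, at a point, applied to a vector.\<close>

fun eta :: "r5 \<Rightarrow> r5 \<Rightarrow> real" where
  "eta (z1, z2, z) (v1, v2, v) =
     v / 2 - ((Im z1 * Re v1 - Re z1 * Im v1) + (Im z2 * Re v2 - Re z2 * Im v2)) / 4"

fun eucl4 :: "r5 \<Rightarrow> r5 \<Rightarrow> real" where
  "eucl4 (u1, u2, u) (v1, v2, v) = Re u1 * Re v1 + Im u1 * Im v1 + Re u2 * Re v2 + Im u2 * Im v2"

definition sasaki_metric :: "r5 \<Rightarrow> r5 \<Rightarrow> r5 \<Rightarrow> real" where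
  "sasaki_metric p u v = eta p u * eta p v + eucl4 u v / 4"

definition reeb :: r5 where
  "reeb = (0, 0, 2)"

text \<open>\<open>\<Omega>\<^sup>T = (dz\<^sub>1 \<and> dz\<^sub>2)/4\<close>, with \<open>(\<sigma> \<and> \<tau>)(u, v) = \<sigma>(u) \<tau>(v) - \<sigma>(v) \<tau>(u)\<close>.\<close>

fun Omega_T :: "r5 \<Rightarrow> r5 \<Rightarrow> complex" where
  "Omega_T (u1, u2, u) (v1, v2, v) = (u1 * v2 - u2 * v1) / 4"

text \<open>Generator of the contact dilations.\<close>

fun dilation_field :: "r5 \<Rightarrow> r5" where
  "dilation_field (z1, z2, z) = (z1, z2, 2 * z)"

section \<open>Legendrian immersions and self-similar solutions\<close>

definition legendrian_immersion :: "'e::euclidean_space set \<Rightarrow> ('e \<Rightarrow> r5) \<Rightarrow> bool" where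
  "legendrian_immersion M F \<longleftrightarrow> immersed_surface M F \<and>
     (\<forall>U \<psi>. surface_chart M U \<psi> \<longrightarrow>
        (\<forall>p\<in>U. \<forall>v. eta (F (\<psi> p)) (frechet_derivative (F \<circ> \<psi>) (at p) v) = 0))"

text \<open>\<open>F\<^sup>*\<Omega>\<^sup>T = exp(-i\<beta>) Vol\<close> for an orientation of \<open>M\<close>. The charts that satisfy the equation
  below are automatically compatibly oriented: under a change of charts the left-hand side is
  multiplied by the Jacobian determinant, and \<open>sqrt (gram_det \<dots>)\<close> by its absolute value.
  So asking for such a chart around every point amounts to a global orientation of \<open>M\<close> for
  which \<open>\<beta>\<close> is the Legendre angle.\<close>

definition legendre_angle ::
    "'e::euclidean_space set \<Rightarrow> ('e \<Rightarrow> r5) \<Rightarrow> ('e \<Rightarrow> real) \<Rightarrow> bool" where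
  "legendre_angle M F \<beta> \<longleftrightarrow> continuous_on M \<beta> \<and>
     (\<forall>q\<in>M. \<exists>U \<psi>. surface_chart M U \<psi> \<and> q \<in> \<psi> ` U \<and>
        (\<forall>p\<in>U. Omega_T (frechet_derivative (F \<circ> \<psi>) (at p) (1,0))
                       (frechet_derivative (F \<circ> \<psi>) (at p) (0,1))
               = cis (- \<beta> (\<psi> p)) * of_real (sqrt (gram_det sasaki_metric (F \<circ> \<psi>) p))))"

text \<open>The equation \<open>H - 2\<beta>\<xi> = a X\<^sup>\<bottom>\<close> at all points of \<open>M\<close>, for a function \<open>\<beta>\<close> on \<open>M\<close>.\<close>

definition soliton_equation ::
    "'e::euclidean_space set \<Rightarrow> ('e \<Rightarrow> r5) \<Rightarrow> ('e \<Rightarrow> real) \<Rightarrow> real \<Rightarrow> bool" where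
  "soliton_equation M F \<beta> a \<longleftrightarrow>
     (\<forall>U \<psi>. surface_chart M U \<psi> \<longrightarrow>
        (\<forall>p\<in>U. mean_curvature sasaki_metric (F \<circ> \<psi>) p - (2 * \<beta> (\<psi> p)) *\<^sub>R reeb
               = a *\<^sub>R normal_part sasaki_metric (F \<circ> \<psi>) p (dilation_field (F (\<psi> p)))))"

definition self_shrinker ::
    "'e::euclidean_space set \<Rightarrow> ('e \<Rightarrow> r5) \<Rightarrow> ('e \<Rightarrow> real) \<Rightarrow> bool" where
  "self_shrinker M F \<beta> \<longleftrightarrow>
     legendrian_immersion M F \<and> legendre_angle M F \<beta> \<and> (\<exists>a<0. soliton_equation M F \<beta> a)"

definition self_expander ::
    "'e::euclidean_space set \<Rightarrow> ('e \<Rightarrow> r5) \<Rightarrow> ('e \<Rightarrow> real) \<Rightarrow> bool" where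
  "self_expander M F \<beta> \<longleftrightarrow>
     legendrian_immersion M F \<and> legendre_angle M F \<beta> \<and> (\<exists>a>0. soliton_equation M F \<beta> a)"

definition self_similar_solution ::
    "'e::euclidean_space set \<Rightarrow> ('e \<Rightarrow> r5) \<Rightarrow> ('e \<Rightarrow> real) \<Rightarrow> bool" where
  "self_similar_solution M F \<beta> \<longleftrightarrow> self_shrinker M F \<beta> \<or> self_expander M F \<beta>"

section \<open>The construction\<close>

definition conic_surface :: "real set \<Rightarrow> real \<Rightarrow> real \<Rightarrow> real \<Rightarrow> (real \<times> real \<times> real) set" where
  "conic_surface I l1 l2 C = {(s, x1, x2). s \<in> I \<and> l1 * x1\<^sup>2 + l2 * x2\<^sup>2 = C}"

definition conic_map ::
    "(real \<Rightarrow> complex) \<Rightarrow> (real \<Rightarrow> complex) \<Rightarrow> (real \<Rightarrow> real) \<Rightarrow> real \<times> real \<times> real \<Rightarrow> r5" where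
  "conic_map w1 w2 z = (\<lambda>(s, x1, x2). (of_real x1 * w1 s, of_real x2 * w2 s, z s))"

end

theory Submission
  imports Defs
begin

text \<open>
  Two observations reduce the soliton equation to a statement about the Legendre angle. First, on
  pairs of contact vectors the Christoffel map of \<open>g\<close> vanishes, so along a Legendrian immersion \<open>f\<close>
  the covariant derivative is the plain second derivative, and differentiating \<open>\<eta>(df) = 0\<close> shows that
  \<open>f\<close> is Lagrangian for \<open>\<omega> = \<Sum>\<^sub>j dx\<^sub>j \<and> dy\<^sub>j\<close> and that \<open>H\<close> has no Reeb component. Symmetry of
  \<open>\<omega>(\<partial>\<^sub>u\<partial>\<^sub>v f, \<partial>\<^sub>w f)\<close> in \<open>u, v, w\<close> turns its trace into the logarithmic derivative of
  \<open>\<Omega>\<^sup>T(f\<^sub>1, f\<^sub>2)\<close>, which is \<open>H = \<Phi>\<nabla>\<beta>\<close>. Second, \<open>X\<close> has Reeb component \<open>z\<close>, and since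
  \<open>\<omega>(X, \<partial>\<^sub>w f) = - 2 \<partial>\<^sub>w z\<close> along a Legendrian, \<open>H - 2\<beta>\<xi> = a X\<^sup>\<bottom>\<close> holds as soon as
  \<open>\<beta> = - a z / 2\<close>. For the construction at hand the Legendre angle is \<open>\<alpha>(s)\<close>, and the equations for
  \<open>z'\<close> and \<open>\<alpha>'\<close> say precisely that \<open>\<alpha> + a z / 2\<close> is constant.
\<close>

section \<open>Smooth maps\<close>

lemma frechet_derivative_eq_on_open:
  assumes "open S" "x \<in> S" "\<And>y. y \<in> S \<Longrightarrow> f y = g y" "f differentiable (at x)"
  shows "g differentiable (at x)" "frechet_derivative g (at x) = frechet_derivative f (at x)"
proof -
  have "(f has_derivative frechet_derivative f (at x)) (at x)"
    using assms(4) frechet_derivative_works by blast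
  then have *: "(g has_derivative frechet_derivative f (at x)) (at x)"
    using assms(1-3) by (rule has_derivative_transform_within_open)
  show "g differentiable (at x)"
    using * differentiable_def by blast
  show "frechet_derivative g (at x) = frechet_derivative f (at x)"
    using frechet_derivative_at[OF *] by simp
qed

lemma Ck_on_cong:
  assumes "open S" "\<And>x. x \<in> S \<Longrightarrow> f x = g x" "Ck_on n S f"
  shows "Ck_on n S g"
  using assms(2,3)
proof (induction n arbitrary: f g)
  case 0
  then show ?case by (simp cong: continuous_on_cong)
next
  case (Suc n)
  have *: "g differentiable (at x)"
      "frechet_derivative g (at x) = frechet_derivative f (at x)" if "x \<in> S" for x
    using frechet_derivative_eq_on_open[OF assms(1) that, of f g] Suc.prems that by auto
  have "Ck_on n S (\<lambda>x. frechet_derivative g (at x) v)" for v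
    by (rule Suc.IH[of "\<lambda>x. frechet_derivative f (at x) v"]) (use * Suc.prems in auto)
  then show ?case using * by simp
qed

text \<open>\<open>Ck_on\<close> recurses through the choice-defined
  \<open>frechet_derivative\<close>. A derivative depends only on the germ, so on an open set any
  explicit formula \<open>f'\<close> can replace it in the recursion; most closure rules below rest
  on this.\<close>

lemma Ck_on_SucI:
  assumes "open S" "\<And>x. x \<in> S \<Longrightarrow> (f has_derivative f' x) (at x)"
    and "\<And>v. Ck_on n S (\<lambda>x. f' x v)"
  shows "Ck_on (Suc n) S f"
proof -
  have *: "frechet_derivative f (at x) = f' x" if "x \<in> S" for x
    using frechet_derivative_at[OF assms(2)[OF that]] by simp
  have "Ck_on n S (\<lambda>x. frechet_derivative f (at x) v)" for v
    by (rule Ck_on_cong[OF assms(1) _ assms(3)[of v]]) (simp add: *)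
  moreover have "f differentiable (at x)" if "x \<in> S" for x
    using assms(2)[OF that] unfolding differentiable_def by blast
  ultimately show ?thesis by simp
qed

lemma Ck_on_SucD: "Ck_on (Suc n) S f \<Longrightarrow> Ck_on n S f"
proof (induction n arbitrary: f)
  case 0
  then show ?case
    by (auto intro!: differentiable_imp_continuous_on
        simp: differentiable_on_def differentiable_at_withinI)
next
  case (Suc n)
  then show ?case by simp
qed

lemma Ck_on_SucE:
  assumes "Ck_on (Suc n) S f" "x \<in> S"
  shows "(f has_derivative frechet_derivative f (at x)) (at x)"
  using assms frechet_derivative_works by auto

lemma Ck_on_const: "Ck_on n S (\<lambda>x. c)"
  by (induction n arbitrary: c) (simp_all add: frechet_derivative_const)

lemma Ck_on_linear:
  assumes "bounded_linear L" "open S"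
  shows "Ck_on n S f \<Longrightarrow> Ck_on n S (\<lambda>x. L (f x))"
proof (induction n arbitrary: f)
  case 0
  then show ?case using assms(1) bounded_linear.continuous_on by auto
next
  case (Suc n)
  show ?case
  proof (rule Ck_on_SucI[OF assms(2)])
    show "((\<lambda>x. L (f x)) has_derivative (\<lambda>v. L (frechet_derivative f (at x) v))) (at x)"
      if "x \<in> S" for x
      using bounded_linear.has_derivative[OF assms(1) Ck_on_SucE[OF Suc.prems that]] .
    show "Ck_on n S (\<lambda>x. L (frechet_derivative f (at x) v))" for v
      using Suc by simp
  qed
qed

lemma Ck_on_id: "open S \<Longrightarrow> Ck_on n S (\<lambda>x. x)"
  by (cases n) (auto intro!: Ck_on_SucI[where f' = "\<lambda>_ v. v"] Ck_on_const simp del: Ck_on.simps(2))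

lemma Ck_on_add:
  assumes "open S"
  shows "Ck_on n S f \<Longrightarrow> Ck_on n S g \<Longrightarrow> Ck_on n S (\<lambda>x. f x + g x)"
proof (induction n arbitrary: f g)
  case 0
  then show ?case by (auto intro: continuous_intros)
next
  case (Suc n)
  show ?case
  proof (rule Ck_on_SucI[OF assms])
    show "((\<lambda>x. f x + g x) has_derivative
        (\<lambda>v. frechet_derivative f (at x) v + frechet_derivative g (at x) v)) (at x)" if "x \<in> S" for x
      using Suc.prems that by (intro has_derivative_add Ck_on_SucE)
    show "Ck_on n S (\<lambda>x. frechet_derivative f (at x) v + frechet_derivative g (at x) v)" for v
      using Suc by simp
  qed
qed

text \<open>A pair is a sum of two linear embeddings, so no new induction is needed.\<close>

lemma Ck_on_Pair:
  assumes "open S" "Ck_on n S f" "Ck_on n S g"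
  shows "Ck_on n S (\<lambda>x. (f x, g x))"
proof -
  have "Ck_on n S (\<lambda>x. (f x, 0) + (0, g x))"
    using assms
    by (intro Ck_on_add Ck_on_linear[where L = "\<lambda>y. (y, 0)"] Ck_on_linear[where L = "\<lambda>y. (0, y)"])
      (auto intro: bounded_linear_Pair bounded_linear_ident bounded_linear_zero)
  then show ?thesis by simp
qed

text \<open>The product rule brings back the undifferentiated factors, hence the induction also uses
  that order \<open>Suc n\<close> implies order \<open>n\<close>.\<close>

lemma (in bounded_bilinear) Ck_on_prod:
  assumes "open S"
  shows "Ck_on n S f \<Longrightarrow> Ck_on n S g \<Longrightarrow> Ck_on n S (\<lambda>x. prod (f x) (g x))"
proof (induction n arbitrary: f g)
  case 0
  then show ?case by (auto intro: continuous_on)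
next
  case (Suc n)
  show ?case
  proof (rule Ck_on_SucI[OF assms])
    show "((\<lambda>x. prod (f x) (g x)) has_derivative (\<lambda>v. prod (f x) (frechet_derivative g (at x) v)
        + prod (frechet_derivative f (at x) v) (g x))) (at x)" if "x \<in> S" for x
      using Suc.prems that by (intro FDERIV Ck_on_SucE)
    show "Ck_on n S (\<lambda>x. prod (f x) (frechet_derivative g (at x) v)
        + prod (frechet_derivative f (at x) v) (g x))" for v
      by (intro Ck_on_add assms Suc.IH; use Suc.prems in \<open>simp add: Ck_on_SucD\<close>)
  qed
qed

lemmas Ck_on_mult = bounded_bilinear.Ck_on_prod[OF bounded_bilinear_mult]
lemmas Ck_on_scaleR = bounded_bilinear.Ck_on_prod[OF bounded_bilinear_scaleR]

lemma Ck_on_inverse: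
  fixes f :: "'a::real_normed_vector \<Rightarrow> real"
  assumes "open S" "\<And>x. x \<in> S \<Longrightarrow> f x \<noteq> 0"
  shows "Ck_on n S f \<Longrightarrow> Ck_on n S (\<lambda>x. inverse (f x))"
proof (induction n)
  case 0
  then show ?case using assms by (auto intro!: continuous_intros)
next
  case (Suc n)
  have f: "Ck_on n S (\<lambda>x. inverse (f x))"
    using Suc Ck_on_SucD by blast
  show ?case
  proof (rule Ck_on_SucI[OF assms(1)])
    show "((\<lambda>x. inverse (f x)) has_derivative
        (\<lambda>v. (- 1) *\<^sub>R (inverse (f x) * frechet_derivative f (at x) v * inverse (f x)))) (at x)"
      if "x \<in> S" for x
      using Deriv.has_derivative_inverse[OF assms(2)[OF that] Ck_on_SucE[OF Suc.prems that]] by simp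
    show "Ck_on n S (\<lambda>x. (- 1) *\<^sub>R (inverse (f x) * frechet_derivative f (at x) v * inverse (f x)))"
      for v
      by (intro Ck_on_scaleR Ck_on_mult Ck_on_const assms f; use Suc.prems in simp)
  qed
qed

text \<open>A real inner map suffices, because \<open>w1\<close>, \<open>w2\<close>,
  \<open>z\<close> enter the immersion only through the coordinate \<open>s\<close>. The derivative
  is then a scalar times \<open>g'(h)\<close>, and the induction varies \<open>g\<close> while
  \<open>h\<close> stays fixed.\<close>

lemma Ck_on_compose_real:
  fixes h :: "'a::real_normed_vector \<Rightarrow> real" and g :: "real \<Rightarrow> 'b::real_normed_vector"
  assumes "open S" "h ` S \<subseteq> T"
  shows "Ck_on n T g \<Longrightarrow> Ck_on n S h \<Longrightarrow> Ck_on n S (\<lambda>x. g (h x))"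
proof (induction n arbitrary: g)
  case 0
  then show ?case using assms
    by (auto intro: continuous_on_compose2)
next
  case (Suc n)
  show ?case
  proof (rule Ck_on_SucI[OF assms(1)])
    show "((\<lambda>x. g (h x)) has_derivative (\<lambda>v. frechet_derivative h (at x) v *\<^sub>R
        frechet_derivative g (at (h x)) 1)) (at x)" if "x \<in> S" for x
    proof -
      have "(g has_derivative frechet_derivative g (at (h x))) (at (h x))"
        using Ck_on_SucE[OF Suc.prems(1)] that assms(2) by blast
      from has_derivative_compose[OF Ck_on_SucE[OF Suc.prems(2) that] this]
      have "((\<lambda>x. g (h x)) has_derivative
          (\<lambda>v. frechet_derivative g (at (h x)) (frechet_derivative h (at x) v))) (at x)" .
      moreover have "frechet_derivative g (at (h x)) t = t *\<^sub>R frechet_derivative g (at (h x)) 1" for t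
        using linear_scale[OF has_derivative_linear[OF \<open>(g has_derivative _) _\<close>], of t 1] by simp
      then have "frechet_derivative g (at (h x)) (frechet_derivative h (at x) v)
          = frechet_derivative h (at x) v *\<^sub>R frechet_derivative g (at (h x)) 1" for v .
      ultimately show ?thesis by (simp only:)
    qed
    show "Ck_on n S (\<lambda>x. frechet_derivative h (at x) v *\<^sub>R frechet_derivative g (at (h x)) 1)" for v
      using Suc.prems
      by (intro Ck_on_scaleR assms Suc.IH[of "\<lambda>y. frechet_derivative g (at y) 1"] Ck_on_SucD[of n S h]) auto
  qed
qed

lemma smooth_onD:
  assumes "smooth_on S f"
  shows "\<And>x. x \<in> S \<Longrightarrow> (f has_derivative frechet_derivative f (at x)) (at x)"
    and "smooth_on S (\<lambda>x. frechet_derivative f (at x) v)"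
    and "continuous_on S f"
proof -
  have *: "Ck_on n S f" for n
    using assms smooth_on_def by blast
  show "\<And>x. x \<in> S \<Longrightarrow> (f has_derivative frechet_derivative f (at x)) (at x)"
    using Ck_on_SucE[OF *] .
  show "smooth_on S (\<lambda>x. frechet_derivative f (at x) v)"
    using *[of "Suc _"] by (auto simp: smooth_on_def)
  show "continuous_on S f" using *[of 0] by simp
qed

lemma smooth_on_fst: "open S \<Longrightarrow> smooth_on S f \<Longrightarrow> smooth_on S (\<lambda>x. fst (f x))"
  and smooth_on_snd: "open S \<Longrightarrow> smooth_on S f \<Longrightarrow> smooth_on S (\<lambda>x. snd (f x))"
  unfolding smooth_on_def by (auto intro: Ck_on_linear bounded_linear_fst bounded_linear_snd)

lemma smooth_on_Pair: "open S \<Longrightarrow> smooth_on S f \<Longrightarrow> smooth_on S g \<Longrightarrow> smooth_on S (\<lambda>x. (f x, g x))"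
  and smooth_on_add: "open S \<Longrightarrow> smooth_on S f \<Longrightarrow> smooth_on S f' \<Longrightarrow> smooth_on S (\<lambda>x. f x + f' x)"
  and smooth_on_id: "open S \<Longrightarrow> smooth_on S (\<lambda>x. x)"
  and smooth_on_const: "smooth_on S (\<lambda>x. c)"
  unfolding smooth_on_def by (auto intro: Ck_on_Pair Ck_on_add Ck_on_id Ck_on_const)

lemma smooth_on_scaleR: "open S \<Longrightarrow> smooth_on S k \<Longrightarrow> smooth_on S g \<Longrightarrow> smooth_on S (\<lambda>x. k x *\<^sub>R g x)"
  unfolding smooth_on_def by (auto intro: Ck_on_scaleR)

lemma smooth_on_mult:
  fixes k g :: "'a::real_normed_vector \<Rightarrow> real"
  shows "open S \<Longrightarrow> smooth_on S k \<Longrightarrow> smooth_on S g \<Longrightarrow> smooth_on S (\<lambda>x. k x * g x)"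
  unfolding smooth_on_def by (auto intro: Ck_on_mult)

lemma smooth_on_divide:
  fixes k g :: "'a::real_normed_vector \<Rightarrow> real"
  assumes "open S" "smooth_on S k" "smooth_on S g" "\<And>x. x \<in> S \<Longrightarrow> g x \<noteq> 0"
  shows "smooth_on S (\<lambda>x. k x / g x)"
  unfolding smooth_on_def divide_inverse
  by (intro allI Ck_on_mult Ck_on_inverse assms; use assms in \<open>simp add: smooth_on_def\<close>)

lemma smooth_on_compose_real:
  fixes h :: "'a::real_normed_vector \<Rightarrow> real"
  assumes "open S" "smooth_on T g" "smooth_on S h" "h ` S \<subseteq> T"
  shows "smooth_on S (\<lambda>x. g (h x))"
  using assms unfolding smooth_on_def by (auto intro: Ck_on_compose_real)

section \<open>Symmetry of second derivatives\<close>

lemma has_real_derivative_along_line: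
  fixes g :: "'a::real_normed_vector \<Rightarrow> real"
  assumes "(g has_derivative g') (at (c + s *\<^sub>R u))"
  shows "((\<lambda>s. g (c + s *\<^sub>R u)) has_real_derivative g' u) (at s)"
proof -
  have "((\<lambda>s. c + s *\<^sub>R u) has_derivative (\<lambda>x. x *\<^sub>R u)) (at s)"
    by (auto intro!: derivative_eq_intros)
  from has_derivative_compose[OF this assms]
  have "((\<lambda>s. g (c + s *\<^sub>R u)) has_derivative (\<lambda>x. g' (x *\<^sub>R u))) (at s)" .
  moreover have "(\<lambda>x. g' (x *\<^sub>R u)) = (*) (g' u)"
    using linear_scale[OF has_derivative_linear[OF assms]] by (auto simp: mult.commute)
  ultimately show ?thesis unfolding has_field_derivative_def by (simp only:)
qed

text \<open>The mean value theorem is applied twice to the second difference over a parallelogram: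
  along \<open>u\<close> to the increment of \<open>f\<close> across \<open>h v\<close>, then along
  \<open>v\<close> to the derivative in direction \<open>u\<close>.\<close>

lemma second_derivative_MVT:
  fixes f :: "'a::real_normed_vector \<Rightarrow> real"
  assumes "smooth_on S f" "0 < h" "\<And>s t. s \<in> {0..h} \<Longrightarrow> t \<in> {0..h} \<Longrightarrow> p + s *\<^sub>R u + t *\<^sub>R v \<in> S"
  obtains s t where "s \<in> {0..h}" "t \<in> {0..h}"
    "f (p + h *\<^sub>R u + h *\<^sub>R v) - f (p + h *\<^sub>R u) - f (p + h *\<^sub>R v) + f p
      = h * h * frechet_derivative (\<lambda>x. frechet_derivative f (at x) u)
          (at (p + s *\<^sub>R u + t *\<^sub>R v)) v"
proof -
  have 1: "((\<lambda>s. f (p + s *\<^sub>R u + t *\<^sub>R v)) has_real_derivative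
      frechet_derivative f (at (p + s *\<^sub>R u + t *\<^sub>R v)) u) (at s)"
    if "s \<in> {0..h}" "t \<in> {0..h}" for s t
  proof -
    have eq: "p + s *\<^sub>R u + t *\<^sub>R v = (p + t *\<^sub>R v) + s *\<^sub>R u" for s
      by simp
    show ?thesis
      using smooth_onD(1)[OF assms(1) assms(3)[OF that]] unfolding eq
      by (rule has_real_derivative_along_line)
  qed
  let ?g = "\<lambda>x. frechet_derivative f (at x) u"
  have 2: "((\<lambda>t. ?g (p + s *\<^sub>R u + t *\<^sub>R v)) has_real_derivative
      frechet_derivative ?g (at (p + s *\<^sub>R u + t *\<^sub>R v)) v) (at t)"
    if "s \<in> {0..h}" "t \<in> {0..h}" for s t
    using smooth_onD(1)[OF smooth_onD(2)[OF assms(1)] assms(3)[OF that]]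
    by (rule has_real_derivative_along_line)
  have "\<exists>s. 0 < s \<and> s < h \<and> (f (p + h *\<^sub>R u + h *\<^sub>R v) - f (p + h *\<^sub>R u + 0 *\<^sub>R v))
      - (f (p + 0 *\<^sub>R u + h *\<^sub>R v) - f (p + 0 *\<^sub>R u + 0 *\<^sub>R v))
      = (h - 0) * (?g (p + s *\<^sub>R u + h *\<^sub>R v) - ?g (p + s *\<^sub>R u + 0 *\<^sub>R v))"
    using assms(2) by (intro MVT2 DERIV_diff 1) auto
  then obtain s where s: "0 < s" "s < h" "(f (p + h *\<^sub>R u + h *\<^sub>R v) - f (p + h *\<^sub>R u + 0 *\<^sub>R v))
      - (f (p + 0 *\<^sub>R u + h *\<^sub>R v) - f (p + 0 *\<^sub>R u + 0 *\<^sub>R v))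
      = (h - 0) * (?g (p + s *\<^sub>R u + h *\<^sub>R v) - ?g (p + s *\<^sub>R u + 0 *\<^sub>R v))"
    by blast
  have "\<exists>t. 0 < t \<and> t < h \<and> ?g (p + s *\<^sub>R u + h *\<^sub>R v) - ?g (p + s *\<^sub>R u + 0 *\<^sub>R v)
      = (h - 0) * frechet_derivative ?g (at (p + s *\<^sub>R u + t *\<^sub>R v)) v"
    using assms(2) s by (intro MVT2 2) auto
  then obtain t where "0 < t" "t < h" "?g (p + s *\<^sub>R u + h *\<^sub>R v) - ?g (p + s *\<^sub>R u + 0 *\<^sub>R v)
      = (h - 0) * frechet_derivative ?g (at (p + s *\<^sub>R u + t *\<^sub>R v)) v" by blast
  with s that[of s t] show thesis by simp
qed

text \<open>The second difference is symmetric in \<open>u\<close> and \<open>v\<close>. So in each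
  small parallelogram one mixed derivative at some point equals the other at some point, and
  continuity carries this to \<open>p\<close>.\<close>

lemma second_derivative_commute_real:
  fixes f :: "'a::real_normed_vector \<Rightarrow> real"
  assumes "open S" "smooth_on S f" "p \<in> S"
  shows "frechet_derivative (\<lambda>x. frechet_derivative f (at x) u) (at p) v
       = frechet_derivative (\<lambda>x. frechet_derivative f (at x) v) (at p) u"
proof (rule ccontr)
  let ?A = "\<lambda>u v p. frechet_derivative (\<lambda>x. frechet_derivative f (at x) u) (at p) v"
  assume ne: "?A u v p \<noteq> ?A v u p"
  \<comment> \<open>Half the gap: two values within \<open>e\<close> of one number cannot be
    \<open>2 * e\<close> apart.\<close>
  define e where "e = \<bar>?A u v p - ?A v u p\<bar> / 2"
  have "e > 0" using ne by (simp add: e_def)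
  have "(?A u v \<longlongrightarrow> ?A u v p) (nhds p)" for u v
  proof -
    have "isCont (?A u v) p"
      using smooth_onD(3)[OF smooth_onD(2)[OF smooth_onD(2)[OF assms(2)]], of u v] assms(1,3)
      by (simp add: continuous_on_eq_continuous_at)
    then show ?thesis
      unfolding isCont_def by (rule tendsto_at_iff_tendsto_nhds[THEN iffD1])
  qed
  then have "\<forall>\<^sub>F x in nhds p. dist (?A u v x) (?A u v p) < e"
    "\<forall>\<^sub>F x in nhds p. dist (?A v u x) (?A v u p) < e"
    using \<open>e > 0\<close> by (auto intro!: tendstoD)
  moreover have "\<forall>\<^sub>F x in nhds p. x \<in> S"
    using assms eventually_nhds_in_open by blast
  ultimately have "\<forall>\<^sub>F x in nhds p. x \<in> S \<and> dist (?A u v x) (?A u v p) < e \<and> dist (?A v u x) (?A v u p) < e"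
    by eventually_elim auto
  then obtain d where "d > 0" and d: "\<And>x. dist x p < d \<Longrightarrow>
      x \<in> S \<and> dist (?A u v x) (?A u v p) < e \<and> dist (?A v u x) (?A v u p) < e"
    unfolding eventually_nhds_metric by blast
  \<comment> \<open>Keeps the parallelogram within distance \<open>d / 2\<close> of
    \<open>p\<close>; the summand 1 covers \<open>u = v = 0\<close>.\<close>
  define h where "h = d / (2 * (norm u + norm v + 1))"
  have N: "norm u + norm v + 1 > 0" by (smt (verit) norm_ge_zero)
  then have "h > 0" using \<open>d > 0\<close> by (simp add: h_def)
  have near: "dist (p + s *\<^sub>R u + t *\<^sub>R v) p < d" if "s \<in> {0..h}" "t \<in> {0..h}" for s t
  proof -
    have "norm (s *\<^sub>R u + t *\<^sub>R v) \<le> s * norm u + t * norm v"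
      using norm_triangle_ineq[of "s *\<^sub>R u" "t *\<^sub>R v"] that by simp
    also have "\<dots> \<le> h * norm u + h * norm v"
      using that by (intro add_mono mult_right_mono) auto
    also have "\<dots> \<le> h * (norm u + norm v + 1)" using \<open>h > 0\<close> by (simp add: algebra_simps)
    also have "\<dots> = d / 2" using N unfolding h_def by (simp add: divide_simps del: distrib_left_numeral)
    finally show ?thesis using \<open>d > 0\<close> by (simp add: dist_norm add.assoc)
  qed
  obtain s t where 1: "s \<in> {0..h}" "t \<in> {0..h}" 
    "f (p + h *\<^sub>R u + h *\<^sub>R v) - f (p + h *\<^sub>R u) - f (p + h *\<^sub>R v) + f p
      = h * h * ?A u v (p + s *\<^sub>R u + t *\<^sub>R v)"
    by (rule second_derivative_MVT[OF assms(2) \<open>h > 0\<close>, of p u v]) (use d near in blast)+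
  have near': "dist (p + s *\<^sub>R v + t *\<^sub>R u) p < d" if "s \<in> {0..h}" "t \<in> {0..h}" for s t
    using near[OF that(2,1)] by (simp add: algebra_simps)
  obtain s' t' where 2: "s' \<in> {0..h}" "t' \<in> {0..h}" 
    "f (p + h *\<^sub>R v + h *\<^sub>R u) - f (p + h *\<^sub>R v) - f (p + h *\<^sub>R u) + f p
      = h * h * ?A v u (p + s' *\<^sub>R v + t' *\<^sub>R u)"
    by (rule second_derivative_MVT[OF assms(2) \<open>h > 0\<close>, of p v u]) (use d near' in blast)+
  have "h * h * ?A u v (p + s *\<^sub>R u + t *\<^sub>R v) = h * h * ?A v u (p + s' *\<^sub>R v + t' *\<^sub>R u)"
    unfolding 1(3)[symmetric] 2(3)[symmetric] by (simp add: algebra_simps)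
  then have "?A u v (p + s *\<^sub>R u + t *\<^sub>R v) = ?A v u (p + s' *\<^sub>R v + t' *\<^sub>R u)"
    using \<open>h > 0\<close> by simp
  then have "dist (?A u v p) (?A u v (p + s *\<^sub>R u + t *\<^sub>R v)) < e"
    "dist (?A v u p) (?A u v (p + s *\<^sub>R u + t *\<^sub>R v)) < e"
    using d[OF near[OF 1(1,2)]] d[OF near'[OF 2(1,2)]] by (simp_all add: dist_commute)
  then have "dist (?A u v p) (?A v u p) < e + e" by (rule dist_triangle_less_add)
  then show False by (simp add: e_def dist_real_def)
qed

lemma frechet_derivative_inner:
  assumes "f differentiable (at x)"
  shows "frechet_derivative (\<lambda>x. f x \<bullet> e) (at x) v = frechet_derivative f (at x) v \<bullet> e"
proof -
  have "(f has_derivative frechet_derivative f (at x)) (at x)"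
    using assms frechet_derivative_works by blast
  from fun_cong[OF frechet_derivative_at[OF has_derivative_inner_left[OF this, of e]], of v]
  show ?thesis by simp
qed

lemma second_derivative_commute:
  fixes f :: "'a::real_normed_vector \<Rightarrow> 'b::euclidean_space"
  assumes "open S" "smooth_on S f" "p \<in> S"
  shows "frechet_derivative (\<lambda>x. frechet_derivative f (at x) u) (at p) v
       = frechet_derivative (\<lambda>x. frechet_derivative f (at x) v) (at p) u"
proof (rule euclidean_eqI)
  fix e :: 'b
  have diff: "g differentiable (at x)" if "smooth_on S g" "x \<in> S" for g :: "'a \<Rightarrow> 'b" and x
    using smooth_onD(1)[OF that] unfolding differentiable_def by blast
  have sm: "smooth_on S (\<lambda>x. f x \<bullet> e)"
    using assms(2) unfolding smooth_on_def
    by (intro allI Ck_on_linear[OF bounded_linear_inner_left assms(1)]) simp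
  have *: "frechet_derivative (\<lambda>x. frechet_derivative (\<lambda>x. f x \<bullet> e) (at x) u) (at p) v
      = frechet_derivative (\<lambda>x. frechet_derivative f (at x) u) (at p) v \<bullet> e" for u v
  proof -
    have "frechet_derivative (\<lambda>x. frechet_derivative (\<lambda>x. f x \<bullet> e) (at x) u) (at p)
        = frechet_derivative (\<lambda>x. frechet_derivative f (at x) u \<bullet> e) (at p)"
    proof (rule frechet_derivative_eq_on_open(2)[OF assms(1,3), symmetric])
      show "frechet_derivative (\<lambda>x. f x \<bullet> e) (at x) u = frechet_derivative f (at x) u \<bullet> e"
        if "x \<in> S" for x
        by (rule frechet_derivative_inner[OF diff[OF assms(2) that]])
      show "(\<lambda>x. frechet_derivative (\<lambda>x. f x \<bullet> e) (at x) u) differentiable at p"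
        using smooth_onD(1)[OF smooth_onD(2)[OF sm] assms(3)] unfolding differentiable_def by blast
    qed
    then show ?thesis
      by (simp only: frechet_derivative_inner[OF diff[OF smooth_onD(2)[OF assms(2)] assms(3)]])
  qed
  from second_derivative_commute_real[OF assms(1) sm assms(3), of u v]
  show "frechet_derivative (\<lambda>x. frechet_derivative f (at x) u) (at p) v \<bullet> e
      = frechet_derivative (\<lambda>x. frechet_derivative f (at x) v) (at p) u \<bullet> e"
    unfolding * .
qed

section \<open>The Sasakian metric\<close>

text \<open>The standard symplectic form on the complex coordinates, equal to twice the exterior
  derivative of \<open>eta\<close>.\<close>

fun symp :: "r5 \<Rightarrow> r5 \<Rightarrow> real" where
  "symp (u1, u2, u) (v1, v2, v) =
     Re u1 * Im v1 - Im u1 * Re v1 + (Re u2 * Im v2 - Im u2 * Re v2)"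

text \<open>The base point enters only through one slot of a bilinear form, so later derivatives of
  \<open>eta\<close> and of the metric are product rules.\<close>

lemma eta_eq_symp: "eta p v = snd (snd v) / 2 + symp p v / 4"
  by (cases p; cases v) (simp add: field_simps)

lemma bounded_bilinear_symp: "bounded_bilinear symp"
  and bounded_bilinear_eucl4: "bounded_bilinear eucl4"
  and bounded_bilinear_Omega_T: "bounded_bilinear Omega_T"
  unfolding bilinear_conv_bounded_bilinear[symmetric] bilinear_def
  by (auto intro!: linearI
      simp: algebra_simps scaleR_conv_of_real add_divide_distrib diff_divide_distrib)

interpretation symp: bounded_bilinear symp
  by (rule bounded_bilinear_symp)

interpretation eucl4: bounded_bilinear eucl4
  by (rule bounded_bilinear_eucl4)

interpretation Omega_T: bounded_bilinear Omega_T
  by (rule bounded_bilinear_Omega_T)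

lemma linear_eta: "linear (eta p)"
  unfolding eta_eq_symp
  by (rule linearI) (simp_all add: symp.add_right symp.scaleR_right add_divide_distrib algebra_simps)

lemmas eta_add = linear_add[OF linear_eta]
  and eta_diff = linear_diff[OF linear_eta]
  and eta_scaleR = linear_scale[OF linear_eta]

lemma symp_self [simp]: "symp u u = 0"
  by (cases u) simp

lemma symp_commute: "symp u v = - symp v u"
  by (cases u; cases v) simp

lemma eucl4_commute: "eucl4 u v = eucl4 v u"
  by (cases u; cases v) simp

lemma sasaki_metric_commute: "sasaki_metric p u v = sasaki_metric p v u"
  by (simp add: sasaki_metric_def eucl4_commute[of u v])

lemma bounded_bilinear_sasaki_metric: "bounded_bilinear (sasaki_metric p)"
  unfolding bilinear_conv_bounded_bilinear[symmetric] bilinear_def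
  by (intro conjI allI linearI; simp add: sasaki_metric_def eta_add eta_scaleR eucl4.add_left eucl4.add_right
      eucl4.scaleR_left eucl4.scaleR_right algebra_simps add_divide_distrib)

lemmas sasaki_add_left = bounded_bilinear.add_left[OF bounded_bilinear_sasaki_metric]
  and sasaki_add_right = bounded_bilinear.add_right[OF bounded_bilinear_sasaki_metric]
  and sasaki_diff_left = bounded_bilinear.diff_left[OF bounded_bilinear_sasaki_metric]
  and sasaki_diff_right = bounded_bilinear.diff_right[OF bounded_bilinear_sasaki_metric]
  and sasaki_scaleR_left = bounded_bilinear.scaleR_left[OF bounded_bilinear_sasaki_metric]
  and sasaki_scaleR_right = bounded_bilinear.scaleR_right[OF bounded_bilinear_sasaki_metric]
  and sasaki_zero_left = bounded_bilinear.zero_left[OF bounded_bilinear_sasaki_metric]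

lemma sasaki_metric_pos:
  assumes "u \<noteq> 0"
  shows "sasaki_metric p u u > 0"
proof -
  obtain u1 u2 u3 where u: "u = (u1, u2, u3)" by (cases u)
  have e: "eucl4 u u = (cmod u1)\<^sup>2 + (cmod u2)\<^sup>2"
    unfolding cmod_power2 by (simp add: u power2_eq_square)
  show ?thesis
  proof (cases "u1 = 0 \<and> u2 = 0")
    case True
    then have "eta p u \<noteq> 0" using assms by (cases p) (simp add: u zero_prod_def)
    then have "eta p u * eta p u > 0" by (metis not_real_square_gt_zero)
    then show ?thesis using e by (simp add: sasaki_metric_def add_pos_nonneg)
  next
    case False
    then have "eucl4 u u > 0" unfolding e by (auto simp: add_pos_nonneg add_nonneg_pos)
    then show ?thesis by (simp add: sasaki_metric_def add_nonneg_pos)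
  qed
qed

lemma sasaki_metric_nondegenerate:
  assumes "\<And>e. sasaki_metric p w e = 0"
  shows "w = 0"
  using assms[of w] sasaki_metric_pos[of w p] by force

lemma frechet_derivative_sasaki_metric:
  "frechet_derivative (\<lambda>x. sasaki_metric x v e) (at p) u
    = (symp u v * eta p e + eta p v * symp u e) / 4"
proof -
  have "((\<lambda>x. sasaki_metric x v e) has_derivative
      (\<lambda>u. eta p v * (symp u e / 4) + (symp u v / 4) * eta p e)) (at p)"
    unfolding sasaki_metric_def eta_eq_symp
    by (auto intro!: derivative_eq_intros bounded_linear.has_derivative[OF symp.bounded_linear_left])
  from fun_cong[OF frechet_derivative_at[OF this, symmetric], of u]
  show ?thesis by (simp add: field_simps)
qed

text \<open>With \<open>eta\<close> zero on both arguments, the Koszul formula retains only a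
  multiple of \<open>(symp u v + symp v u) * eta p e\<close>, which antisymmetry cancels.
  Nondegeneracy then makes zero the unique solution.\<close>

lemma christoffel_sasaki_contact:
  assumes "eta p u = 0" "eta p v = 0"
  shows "christoffel sasaki_metric p u v = 0"
  unfolding christoffel_def frechet_derivative_sasaki_metric
proof (rule the_equality)
  show "\<forall>e. sasaki_metric p 0 e = ((symp u v * eta p e + eta p v * symp u e) / 4 +
      (symp v u * eta p e + eta p u * symp v e) / 4 - (symp e u * eta p v + eta p u * symp e v) / 4) / 2"
    using assms by (simp add: sasaki_zero_left symp_commute[of v u])
next
  fix w
  assume *: "\<forall>e. sasaki_metric p w e = ((symp u v * eta p e + eta p v * symp u e) / 4 +
      (symp v u * eta p e + eta p u * symp v e) / 4 - (symp e u * eta p v + eta p u * symp e v) / 4) / 2"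
  have "sasaki_metric p w e = 0" for e
    using spec[OF *, of e] assms by (simp add: symp_commute[of v u])
  then show "w = 0" by (rule sasaki_metric_nondegenerate)
qed

lemma gram_det_pos:
  assumes "linear (frechet_derivative f (at p))" "inj (frechet_derivative f (at p))"
  shows "gram_det sasaki_metric f p > 0"
proof -
  let ?D = "frechet_derivative f (at p)" and ?G = "sasaki_metric (f p)"
  have inj: "?D v \<noteq> 0" if "v \<noteq> 0" for v
    using assms that linear_injective_0 by blast
  let ?a = "?G (?D (1,0)) (?D (1,0))" and ?b = "?G (?D (1,0)) (?D (0,1))"
  let ?c = "?G (?D (0,1)) (?D (0,1))"
  have a: "?a > 0" by (intro sasaki_metric_pos inj) (simp add: zero_prod_def)
  \<comment> \<open>Gram-Schmidt without division: \<open>?w\<close> is \<open>?a\<close> times the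
    part of the second tangent vector orthogonal to the first, so its squared norm is
    \<open>?a\<close> times the Gram determinant.\<close>
  let ?w = "?a *\<^sub>R ?D (0,1) - ?b *\<^sub>R ?D (1,0)"
  have "?w = ?D (- ?b, ?a)"
  proof -
    have "?D (- ?b, ?a) = ?D ((- ?b) *\<^sub>R (1,0) + ?a *\<^sub>R (0,1))" by simp
    also have "\<dots> = ?w"
      unfolding linear_add[OF assms(1)] linear_scale[OF assms(1)] by simp
    finally show ?thesis by simp
  qed
  then have "?w \<noteq> 0" using inj[of "(- ?b, ?a)"] a by (simp add: zero_prod_def)
  then have "?G ?w ?w > 0" by (rule sasaki_metric_pos)
  also have "?G ?w ?w = ?a * (?a * ?c - ?b * ?b)"
    by (simp add: sasaki_diff_left sasaki_diff_right sasaki_scaleR_left sasaki_scaleR_right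
        sasaki_metric_commute[of "f p" "?D (0,1)" "?D (1,0)"] algebra_simps)
  finally show ?thesis
    using a unfolding gram_det_def first_ff_def
    by (simp add: sasaki_metric_commute[of "f p" "?D (0,1)" "?D (1,0)"] zero_less_mult_iff)
qed

section \<open>Orthogonal projection onto the normal space\<close>

lemma linear_prod_decomp:
  assumes "linear (D :: real \<times> real \<Rightarrow> 'a::real_vector)"
  shows "D v = fst v *\<^sub>R D (1,0) + snd v *\<^sub>R D (0,1)"
proof -
  have "D v = D (fst v *\<^sub>R (1,0) + snd v *\<^sub>R (0,1))" by simp
  then show ?thesis unfolding linear_add[OF assms] linear_scale[OF assms] .
qed

text \<open>Evaluates the definite description. Uniqueness: the difference of two candidates is both
  tangent and orthogonal to all tangent vectors.\<close>

lemma normal_part_sasaki: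
  assumes lin: "linear (frechet_derivative f (at p))" and inj: "inj (frechet_derivative f (at p))"
  shows "sasaki_metric (f p) (normal_part sasaki_metric f p Y) (frechet_derivative f (at p) v) = 0"
    and "Y - normal_part sasaki_metric f p Y \<in> range (frechet_derivative f (at p))"
proof -
  let ?D = "frechet_derivative f (at p)" and ?G = "sasaki_metric (f p)"
  define g11 g12 g22 d y1 y2 where defs: "g11 = ?G (?D (1,0)) (?D (1,0))" 
    "g12 = ?G (?D (1,0)) (?D (0,1))" "g22 = ?G (?D (0,1)) (?D (0,1))"
    "d = g11 * g22 - g12 * g12"
    "y1 = ?G Y (?D (1,0))" "y2 = ?G Y (?D (0,1))"
  have d: "d \<noteq> 0"
    using gram_det_pos[OF assms] unfolding gram_det_def first_ff_def defs
    by (simp add: sasaki_metric_commute[of "f p" "?D (0,1)" "?D (1,0)"])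
  \<comment> \<open>Cramer's rule for the coefficients of the tangential part of
    \<open>Y\<close>.\<close>
  define c where "c = ((y1 * g22 - y2 * g12) / d, (y2 * g11 - y1 * g12) / d)"
  have c: "?D c = fst c *\<^sub>R ?D (1,0) + snd c *\<^sub>R ?D (0,1)"
    by (rule linear_prod_decomp[OF lin])
  let ?P = "\<lambda>n. (\<forall>v. ?G n (?D v) = 0) \<and> Y - n \<in> range ?D"
  have "?P (Y - ?D c)"
  proof (intro conjI allI)
    have 1: "?G (Y - ?D c) (?D (1,0)) = 0"
    proof -
      have "?G (Y - ?D c) (?D (1,0)) = y1 - (fst c * g11 + snd c * g12)"
        by (simp add: c sasaki_diff_left sasaki_add_left sasaki_scaleR_left defs
            sasaki_metric_commute[of "f p" "?D (0,1)" "?D (1,0)"])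
      also have "\<dots> = 0" using d by (simp add: c_def field_simps) (simp add: defs algebra_simps)
      finally show ?thesis .
    qed
    have 2: "?G (Y - ?D c) (?D (0,1)) = 0"
    proof -
      have "?G (Y - ?D c) (?D (0,1)) = y2 - (fst c * g12 + snd c * g22)"
        by (simp add: c sasaki_diff_left sasaki_add_left sasaki_scaleR_left defs)
      also have "\<dots> = 0" using d by (simp add: c_def field_simps) (simp add: defs algebra_simps)
      finally show ?thesis .
    qed
    show "?G (Y - ?D c) (?D v) = 0" for v
      unfolding linear_prod_decomp[OF lin, of v]
      by (simp add: sasaki_add_right sasaki_scaleR_right 1 2)
  qed simp
  moreover have "n = m" if n: "?P n" and m: "?P m" for n m
  proof -
    obtain k where k: "Y - m = ?D k" using m by blast
    obtain l where l: "Y - n = ?D l" using n by blast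
    have *: "n - m = ?D (k - l)"
      unfolding linear_diff[OF lin] k[symmetric] l[symmetric] by simp
    have "?G (n - m) (n - m) = 0"
      unfolding sasaki_diff_left using n m by (simp only: *)
    then show ?thesis using sasaki_metric_pos[of "n - m" "f p"] by force
  qed
  ultimately have "\<exists>!n. ?P n" by blast
  from theI'[OF this] show "?G (normal_part sasaki_metric f p Y) (?D v) = 0"
    "Y - normal_part sasaki_metric f p Y \<in> range ?D"
    unfolding normal_part_def by blast+
qed

text \<open>Up to sign, \<open>eucl4\<close> and \<open>symp\<close> are the real and imaginary
  parts of the Hermitian product of the complex coordinates, and \<open>Omega_T\<close> is a quarter
  of their determinant. This is the Hermitian Gram identity.\<close>

lemma eucl4_gram:
  "eucl4 a a * eucl4 b b - eucl4 a b * eucl4 b a = 16 * (cmod (Omega_T a b))\<^sup>2 + (symp a b)\<^sup>2"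
  by (cases a; cases b) (simp add: norm_divide power_divide cmod_power2,
      simp add: power2_eq_square field_simps)

text \<open>The imaginary part of the polarised Gram identity, for the first-order variation of the
  determinant when \<open>a\<close>, \<open>b\<close> move in directions \<open>c\<close>,
  \<open>d\<close>. The last summand drops out on Lagrangian planes.\<close>

lemma Omega_T_symp:
  "16 * Im ((Omega_T c b + Omega_T a d) * cnj (Omega_T a b)) =
     eucl4 a b * symp c b + eucl4 a b * symp d a - eucl4 b b * symp c a - eucl4 a a * symp d b
     + symp a b * (eucl4 d a - eucl4 c b)"
  by (cases a; cases b; cases c; cases d) (simp add: field_simps)

text \<open>The four pairings say that the complex part of \<open>E\<close> is Hermitian-orthogonal
  to \<open>a\<close> and \<open>b\<close>, a complex basis by the determinant condition. Then
  \<open>eta\<close> removes the vertical component.\<close>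

lemma normal_vector_zero:
  assumes "Omega_T a b \<noteq> 0" "eta p E = 0" "eucl4 E a = 0" "eucl4 E b = 0" "symp E a = 0" "symp E b = 0"
  shows "E = 0"
proof -
  obtain E1 E2 E3 where E: "E = (E1, E2, E3)" by (cases E)
  obtain a1 a2 a3 where a: "a = (a1, a2, a3)" by (cases a)
  obtain b1 b2 b3 where b: "b = (b1, b2, b3)" by (cases b)
  have 1: "cnj E1 * a1 + cnj E2 * a2 = 0" "cnj E1 * b1 + cnj E2 * b2 = 0"
    using assms(3-6) by (simp_all add: complex_eq_iff E a b algebra_simps)
  have "cnj E1 * (a1 * b2 - a2 * b1) = (cnj E1 * a1 + cnj E2 * a2) * b2 - (cnj E1 * b1 + cnj E2 * b2) * a2"
    "cnj E2 * (a1 * b2 - a2 * b1) = (cnj E1 * b1 + cnj E2 * b2) * a1 - (cnj E1 * a1 + cnj E2 * a2) * b1"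
    by (simp_all add: algebra_simps)
  then have "cnj E1 * (a1 * b2 - a2 * b1) = 0" "cnj E2 * (a1 * b2 - a2 * b1) = 0"
    unfolding 1 by simp_all
  with assms(1) have "E1 = 0" "E2 = 0" by (simp_all add: a b)
  then show ?thesis using assms(2) by (cases p) (simp add: E zero_prod_def)
qed

section \<open>Legendrian surfaces\<close>

lemma derivative_of_zero:
  fixes g :: "'a::real_normed_vector \<Rightarrow> real"
  assumes "open U" "p \<in> U" "\<And>q. q \<in> U \<Longrightarrow> g q = 0" "(g has_derivative g') (at p)"
  shows "g' u = 0"
proof -
  have "((\<lambda>q. 0) has_derivative g') (at p)"
    using assms(4,1,2) by (rule has_derivative_transform_within_open) (use assms(3) in auto)
  then have "g' = (\<lambda>u. 0)"
    by (rule has_derivative_unique) simp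
  then show ?thesis by simp
qed

locale legendrian_patch =
  fixes U :: "(real \<times> real) set" and f :: "real \<times> real \<Rightarrow> r5"
  assumes open_U: "open U"
    and smooth_f: "smooth_on U f"
    and inj_D: "p \<in> U \<Longrightarrow> inj (frechet_derivative f (at p))"
    and eta_D: "p \<in> U \<Longrightarrow> eta (f p) (frechet_derivative f (at p) v) = 0"
begin

abbreviation D :: "real \<times> real \<Rightarrow> real \<times> real \<Rightarrow> r5" where
  "D p v \<equiv> frechet_derivative f (at p) v"

abbreviation DD :: "real \<times> real \<Rightarrow> real \<times> real \<Rightarrow> real \<times> real \<Rightarrow> r5" where
  "DD p u v \<equiv> frechet_derivative (\<lambda>q. D q v) (at p) u"

lemma has_D: "p \<in> U \<Longrightarrow> (f has_derivative D p) (at p)"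
  by (rule smooth_onD(1)[OF smooth_f])

lemma has_DD: "p \<in> U \<Longrightarrow> ((\<lambda>q. D q v) has_derivative (\<lambda>u. DD p u v)) (at p)"
  by (rule smooth_onD(1)[OF smooth_onD(2)[OF smooth_f]])

lemma linear_D: "p \<in> U \<Longrightarrow> linear (D p)"
  using has_D has_derivative_linear by blast

lemma DD_commute: "p \<in> U \<Longrightarrow> DD p u v = DD p v u"
  by (rule second_derivative_commute[OF open_U smooth_f])

text \<open>Differentiates the Legendrian condition for direction \<open>v\<close> along
  \<open>u\<close>; the symplectic term comes from the motion of the base point.\<close>

lemma eta_DD_symp: "p \<in> U \<Longrightarrow> symp (D p u) (D p v) / 4 + eta (f p) (DD p u v) = 0"
proof -
  assume p: "p \<in> U"
  have "((\<lambda>q. snd (snd (D q v)) / 2 + symp (f q) (D q v) / 4) has_derivative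
      (\<lambda>u. snd (snd (DD p u v)) / 2 + (symp (f p) (DD p u v) + symp (D p u) (D p v)) / 4)) (at p)"
    by (auto intro!: derivative_eq_intros symp.FDERIV has_D has_DD p)
  from derivative_of_zero[OF open_U p _ this, of u] eta_D[of _ v]
  show ?thesis unfolding eta_eq_symp by (simp add: field_simps)
qed

text \<open>In the previous identity the second derivative is symmetric in \<open>u\<close>,
  \<open>v\<close> while \<open>symp\<close> is antisymmetric.\<close>

lemma symp_D:
  assumes "p \<in> U"
  shows "symp (D p u) (D p v) = 0"
proof -
  have "symp (D p u) (D p v) = symp (D p v) (D p u)"
    using eta_DD_symp[OF assms, of u v] eta_DD_symp[OF assms, of v u] DD_commute[OF assms, of u v]
    by simp
  then show ?thesis using symp_commute[of "D p u" "D p v"] by linarith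
qed

lemma eta_DD: "p \<in> U \<Longrightarrow> eta (f p) (DD p u v) = 0"
  using eta_DD_symp[of p u v] symp_D[of p u v] by simp

text \<open>Differentiating the Lagrangian condition exchanges \<open>v\<close> and
  \<open>w\<close>; together with the symmetry of \<open>DD\<close> the cubic form
  \<open>symp (DD p u v) (D p w)\<close> is totally symmetric.\<close>

lemma symp_DD:
  assumes "p \<in> U"
  shows "symp (DD p u v) (D p w) = symp (DD p w u) (D p v)"
proof -
  have "((\<lambda>q. symp (D q v) (D q w)) has_derivative
      (\<lambda>u. symp (D p v) (DD p u w) + symp (DD p u v) (D p w))) (at p)"
    by (intro symp.FDERIV has_DD assms)
  from derivative_of_zero[OF open_U assms symp_D this, of u]
  have "symp (D p v) (DD p u w) + symp (DD p u v) (D p w) = 0" by simp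
  then show ?thesis
    using symp_commute[of "D p v" "DD p u w"] DD_commute[OF assms, of u w] by simp
qed

lemma cov_deriv_eq: "p \<in> U \<Longrightarrow> cov_deriv sasaki_metric f p u v = DD p u v"
  unfolding cov_deriv_def by (simp add: christoffel_sasaki_contact eta_D)

lemma eta_normal_part: "p \<in> U \<Longrightarrow> eta (f p) (normal_part sasaki_metric f p Y) = eta (f p) Y"
  using normal_part_sasaki(2)[OF linear_D inj_D, of p Y] eta_D[of p]
  by (auto simp: eta_diff dest!: arg_cong[where f = "eta (f p)"])

lemma symp_normal_part:
  assumes p: "p \<in> U"
  shows "symp (normal_part sasaki_metric f p Y) (D p w) = symp Y (D p w)"
proof -
  obtain k where "Y - normal_part sasaki_metric f p Y = D p k"
    using normal_part_sasaki(2)[OF linear_D inj_D, OF p p, of Y] by blast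
  then have "symp (Y - normal_part sasaki_metric f p Y) (D p w) = 0"
    using symp_D[OF p] by simp
  then show ?thesis by (simp add: symp.diff_left)
qed

lemma first_ff_eq: "p \<in> U \<Longrightarrow> first_ff sasaki_metric f p u v = eucl4 (D p u) (D p v) / 4"
  unfolding first_ff_def sasaki_metric_def by (simp add: eta_D)

lemma gram_det_eq:
  assumes "p \<in> U"
  shows "gram_det sasaki_metric f p = (cmod (Omega_T (D p (1,0)) (D p (0,1))))\<^sup>2"
  unfolding gram_det_def using assms eucl4_gram[of "D p (1,0)" "D p (0,1)"]
  by (simp add: first_ff_eq symp_D)

text \<open>Total symmetry moves \<open>w\<close> into the second derivatives. The trace then
  becomes the right-hand side of \<open>Omega_T_symp\<close>, with \<open>c\<close>,
  \<open>d\<close> the derivatives along \<open>w\<close> of the two tangent vectors; the quarter in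
  the metric turns 16 into 4.\<close>

lemma symp_mean_curvature:
  assumes p: "p \<in> U"
  shows "gram_det sasaki_metric f p * symp (mean_curvature sasaki_metric f p) (D p w)
    = - 4 * Im ((Omega_T (DD p w (1,0)) (D p (0,1)) + Omega_T (D p (1,0)) (DD p w (0,1)))
               * cnj (Omega_T (D p (1,0)) (D p (0,1))))"
proof -
  have "gram_det sasaki_metric f p \<noteq> 0"
    using gram_det_pos[OF linear_D inj_D, OF p p] by simp
  then have "gram_det sasaki_metric f p * symp (mean_curvature sasaki_metric f p) (D p w)
    = (eucl4 (D p (0,1)) (D p (0,1)) * symp (DD p w (1,0)) (D p (1,0))
       - eucl4 (D p (1,0)) (D p (0,1)) * symp (DD p w (1,0)) (D p (0,1))
       - eucl4 (D p (0,1)) (D p (1,0)) * symp (DD p w (0,1)) (D p (1,0))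
       + eucl4 (D p (1,0)) (D p (1,0)) * symp (DD p w (0,1)) (D p (0,1))) / 4"
    unfolding mean_curvature_def second_ff_def
    by (simp add: symp.scaleR_left symp.add_left symp.diff_left symp_normal_part p cov_deriv_eq
        first_ff_eq symp_DD[OF p, of _ _ w] right_diff_distrib distrib_left add_divide_distrib
        diff_divide_distrib)
  then show ?thesis
    using Omega_T_symp[of "DD p w (1,0)" "D p (0,1)" "D p (1,0)" "DD p w (0,1)"]
    by (simp add: symp_D p eucl4_commute[of "D p (0,1)" "D p (1,0)"] del: times_complex.sel)
qed

lemma eta_mean_curvature: "p \<in> U \<Longrightarrow> eta (f p) (mean_curvature sasaki_metric f p) = 0"
  unfolding mean_curvature_def second_ff_def
  by (simp add: eta_scaleR eta_add eta_diff eta_normal_part cov_deriv_eq eta_DD)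

lemma sasaki_normal_part: "p \<in> U \<Longrightarrow> sasaki_metric (f p) (normal_part sasaki_metric f p Y) (D p v) = 0"
  by (rule normal_part_sasaki(1)[OF linear_D inj_D])

lemma sasaki_mean_curvature:
  "p \<in> U \<Longrightarrow> sasaki_metric (f p) (mean_curvature sasaki_metric f p) (D p v) = 0"
  unfolding mean_curvature_def second_ff_def
  by (simp add: sasaki_scaleR_left sasaki_add_left sasaki_diff_left sasaki_normal_part)

text \<open>Differentiating the reality of \<open>\<Omega>\<^sup>T(f\<^sub>1, f\<^sub>2) e\<^sup>i\<^sup>\<beta>\<close> gives \<open>d\<beta>\<close> as minus the imaginary part of
  the logarithmic derivative of \<open>\<Omega>\<^sup>T(f\<^sub>1, f\<^sub>2)\<close>; this is how \<open>H = \<Phi>\<nabla>\<beta>\<close> enters.\<close>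

lemma derivative_angle:
  assumes p: "p \<in> U"
    and angle: "\<And>q. q \<in> U \<Longrightarrow> Im (Omega_T (D q (1,0)) (D q (0,1)) * cis (\<beta> q)) = 0"
    and \<beta>: "(\<beta> has_derivative \<beta>') (at p)"
  shows "Im ((Omega_T (DD p w (1,0)) (D p (0,1)) + Omega_T (D p (1,0)) (DD p w (0,1)))
               * cnj (Omega_T (D p (1,0)) (D p (0,1))))
       = - \<beta>' w * gram_det sasaki_metric f p"
proof -
  let ?O = "\<lambda>q. Omega_T (D q (1,0)) (D q (0,1))"
  let ?O' = "\<lambda>w. Omega_T (D p (1,0)) (DD p w (0,1)) + Omega_T (DD p w (1,0)) (D p (0,1))"
  have O: "(?O has_derivative ?O') (at p)"
    by (intro Omega_T.FDERIV has_DD p)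
  \<comment> \<open>The expanded imaginary part of \<open>?O q * cis (\<beta> q)\<close>, a function
    that vanishes on \<open>U\<close>.\<close>
  have "((\<lambda>q. Re (?O q) * sin (\<beta> q) + Im (?O q) * cos (\<beta> q)) has_derivative
      (\<lambda>w. Re (?O p) * (\<beta>' w * cos (\<beta> p)) + Re (?O' w) * sin (\<beta> p)
          + (Im (?O p) * (\<beta>' w * - sin (\<beta> p)) + Im (?O' w) * cos (\<beta> p)))) (at p)"
    by (intro has_derivative_add has_derivative_mult has_derivative_Re[OF O] has_derivative_Im[OF O]
        has_derivative_sin[OF \<beta>] has_derivative_cos[OF \<beta>])
  from derivative_of_zero[OF open_U p _ this, of w] angle
  have 1: "Re (?O p) * (\<beta>' w * cos (\<beta> p)) + Re (?O' w) * sin (\<beta> p)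
          + (Im (?O p) * (\<beta>' w * - sin (\<beta> p)) + Im (?O' w) * cos (\<beta> p)) = 0"
    by (simp add: add.commute)
  have 2: "Re (?O p) * sin (\<beta> p) + Im (?O p) * cos (\<beta> p) = 0"
    using angle[OF p] by (simp add: add.commute)
  have 3: "sin (\<beta> p) * sin (\<beta> p) = 1 - cos (\<beta> p) * cos (\<beta> p)"
    using sin_cos_squared_add[of "\<beta> p"] by (simp add: power2_eq_square algebra_simps)
  \<comment> \<open>Rotating \<open>x\<close> and \<open>y\<close> by the same unit number
    \<open>c + i s\<close> preserves \<open>Im (x * cnj y)\<close> and makes \<open>y\<close> real:
    \<open>?P\<close> is the real part of the rotated \<open>y\<close>, and the expression assumed
    to vanish in \<open>Q\<close> its imaginary part.\<close>
  have real_part: "Im (x * cnj y) = - t * (Re y * Re y + Im y * Im y)"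
    if dt: "Re y * (t * c) + Re x * s + (Im y * (t * - s) + Im x * c) = 0"
      and Q: "Re y * s + Im y * c = 0" and sc: "s * s = 1 - c * c" for x y :: complex and s c t :: real
  proof -
    let ?P = "Re y * c - Im y * s"
    have "Im (x * cnj y) = (Im x * Re y - Re x * Im y) * (s * s + c * c)"
      using sc by simp
    also have "\<dots> = (Re x * s + Im x * c) * ?P - (Re x * c - Im x * s) * (Re y * s + Im y * c)"
      by (simp add: algebra_simps)
    also have "\<dots> = (Re x * s + Im x * c) * ?P" unfolding Q by simp
    also have "Re x * s + Im x * c = - t * ?P" using dt by (simp add: algebra_simps)
    also have "- t * ?P * ?P = - t * (?P * ?P + (Re y * s + Im y * c) * (Re y * s + Im y * c))"
      unfolding Q by simp
    also have "?P * ?P + (Re y * s + Im y * c) * (Re y * s + Im y * c)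
        = (Re y * Re y + Im y * Im y) * (s * s + c * c)"
      by (simp add: algebra_simps)
    finally show ?thesis using sc by simp
  qed
  from real_part[OF 1 2 3] show ?thesis
    unfolding gram_det_eq[OF p] cmod_power2 unfolding power2_eq_square by (subst add.commute)
qed

text \<open>The difference \<open>E\<close> of the two sides is fed to
  \<open>normal_vector_zero\<close>. The constant \<open>\<theta>\<close> is free because only the
  differential of the angle enters \<open>H\<close>; the Reeb term is written through the height
  itself.\<close>

theorem soliton_of_angle:
  assumes p: "p \<in> U"
    and angle: "\<And>q. q \<in> U \<Longrightarrow>
      Im (Omega_T (D q (1,0)) (D q (0,1)) * cis (\<theta> - a / 2 * snd (snd (f q)))) = 0"
  shows "mean_curvature sasaki_metric f p + (a * snd (snd (f p))) *\<^sub>R reeb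
       = a *\<^sub>R normal_part sasaki_metric f p (dilation_field (f p))"
proof -
  have det: "gram_det sasaki_metric f p > 0"
    using gram_det_pos[OF linear_D inj_D, OF p p] .
  define E where "E = mean_curvature sasaki_metric f p + (a * snd (snd (f p))) *\<^sub>R reeb
       - a *\<^sub>R normal_part sasaki_metric f p (dilation_field (f p))"
  have reeb: "eta x reeb = 1" "symp reeb v = 0" "eucl4 reeb v = 0" for x v
    by (cases x; cases v; simp add: reeb_def)+
  have X: "eta x (dilation_field x) = snd (snd x)" "symp (dilation_field x) v = symp x v" for x v
    by (cases x; cases v; simp)+
  have eta: "eta (f p) E = 0"
    unfolding E_def
    by (simp add: eta_add eta_diff eta_scaleR eta_mean_curvature eta_normal_part p reeb X)
  have eucl: "eucl4 E (D p w) = 0" for w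
  proof -
    have "sasaki_metric (f p) reeb (D p w) = 0"
      by (simp add: sasaki_metric_def eta_D p reeb)
    then have "sasaki_metric (f p) E (D p w) = 0"
      unfolding E_def by (simp add: sasaki_add_left sasaki_diff_left sasaki_scaleR_left
          sasaki_mean_curvature sasaki_normal_part p)
    then show ?thesis by (simp add: sasaki_metric_def eta_D p)
  qed
  have symp: "symp E (D p w) = 0" for w
  proof -
    have "((\<lambda>q. \<theta> - a / 2 * snd (snd (f q))) has_derivative
        (\<lambda>w. 0 - a / 2 * snd (snd (D p w)))) (at p)"
      by (intro derivative_intros has_D p)
    note 1 = derivative_angle[OF p angle this, of w]
    have "gram_det sasaki_metric f p * symp (mean_curvature sasaki_metric f p) (D p w)
        = gram_det sasaki_metric f p * (- 2 * a * snd (snd (D p w)))"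
      by (simp add: symp_mean_curvature[OF p] 1 del: times_complex.sel)
    then have "symp (mean_curvature sasaki_metric f p) (D p w) = - 2 * a * snd (snd (D p w))"
      using det by (metis mult_left_cancel order_less_irrefl)
    \<comment> \<open>The Legendrian condition again: pairing the dilation field with a tangent
      vector gives the derivative of the height, matching the pairing with \<open>H\<close>.\<close>
    moreover have "symp (f p) (D p w) = - 2 * snd (snd (D p w))"
      using eta_D[OF p, of w] unfolding eta_eq_symp by simp
    ultimately show ?thesis
      unfolding E_def
      by (simp add: symp.add_left symp.diff_left symp.scaleR_left reeb X symp_normal_part p)
  qed
  have "Omega_T (D p (1,0)) (D p (0,1)) \<noteq> 0"
    using det by (auto simp: gram_det_eq p)
  from normal_vector_zero[OF this eta eucl eucl symp symp] show ?thesis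
    by (simp add: E_def)
qed

end

section \<open>The surface over a conic\<close>

text \<open>The system without phases: \<open>r1 r2 sin (\<alpha> + \<phi>)\<close> is the imaginary
  part of \<open>cis \<alpha> * w1 * w2\<close>, so \<open>u\<close>, \<open>Q\<close> and the
  angles of \<open>w1\<close>, \<open>w2\<close> disappear.\<close>

locale conic_curve =
  fixes l1 l2 C :: real and I :: "real set" and \<alpha> z :: "real \<Rightarrow> real" and w1 w2 :: "real \<Rightarrow> complex"
  assumes nonzero: "l1 \<noteq> 0" "l2 \<noteq> 0" "C \<noteq> 0"
    and open_I: "open I"
    and smooth: "smooth_on I w1" "smooth_on I w2" "smooth_on I z" "smooth_on I \<alpha>"
    and w_nonzero: "s \<in> I \<Longrightarrow> w1 s \<noteq> 0" "s \<in> I \<Longrightarrow> w2 s \<noteq> 0"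
    and w1': "s \<in> I \<Longrightarrow> (w1 has_vector_derivative l1 * cis (- \<alpha> s) * cnj (w2 s)) (at s)"
    and w2': "s \<in> I \<Longrightarrow> (w2 has_vector_derivative l2 * cis (- \<alpha> s) * cnj (w1 s)) (at s)"
    and z': "s \<in> I \<Longrightarrow> (z has_real_derivative C / 2 * Im (cis (\<alpha> s) * w1 s * w2 s)) (at s)"
begin

abbreviation M :: "(real \<times> real \<times> real) set" where
  "M \<equiv> conic_surface I l1 l2 C"

abbreviation F :: "real \<times> real \<times> real \<Rightarrow> r5" where
  "F \<equiv> conic_map w1 w2 z"

text \<open>The differential of \<open>F\<close> in the ambient space, with the derivatives of
  \<open>w1\<close>, \<open>w2\<close>, \<open>z\<close> replaced by the right-hand sides of the
  system.\<close>

fun dF :: "real \<times> real \<times> real \<Rightarrow> real \<times> real \<times> real \<Rightarrow> r5" where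
  "dF (s, x, y) (s', x', y') =
     ((x * s') *\<^sub>R (l1 * cis (- \<alpha> s) * cnj (w2 s)) + x' *\<^sub>R w1 s,
      (y * s') *\<^sub>R (l2 * cis (- \<alpha> s) * cnj (w1 s)) + y' *\<^sub>R w2 s,
      s' * (C / 2 * Im (cis (\<alpha> s) * w1 s * w2 s)))"

lemma has_derivative_F:
  assumes "q \<in> M"
  shows "(F has_derivative dF q) (at q)"
proof -
  obtain s x y where q: "q = (s, x, y)" "s \<in> I"
    using assms by (auto simp: conic_surface_def)
  have F: "F = (\<lambda>p. (fst (snd p) *\<^sub>R w1 (fst p), snd (snd p) *\<^sub>R w2 (fst p), z (fst p)))"
    by (auto simp: conic_map_def scaleR_conv_of_real)
  have w: "(w1 has_derivative (\<lambda>h. h *\<^sub>R (l1 * cis (- \<alpha> s) * cnj (w2 s)))) (at (fst q))"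
    "(w2 has_derivative (\<lambda>h. h *\<^sub>R (l2 * cis (- \<alpha> s) * cnj (w1 s)))) (at (fst q))"
    "(z has_derivative (\<lambda>h. (C / 2 * Im (cis (\<alpha> s) * w1 s * w2 s)) * h)) (at (fst q))"
    using w1'[OF q(2)] w2'[OF q(2)] z'[OF q(2)]
    unfolding has_vector_derivative_def has_field_derivative_def q(1) fst_conv .
  have c: "(fst has_derivative fst) (at q)" "((\<lambda>p. fst (snd p)) has_derivative (\<lambda>v. fst (snd v))) (at q)"
    "((\<lambda>p. snd (snd p)) has_derivative (\<lambda>v. snd (snd v))) (at q)"
    by (auto intro!: derivative_eq_intros)
  have "(F has_derivative (\<lambda>v.
      (fst (snd q) *\<^sub>R (fst v *\<^sub>R (l1 * cis (- \<alpha> s) * cnj (w2 s))) + fst (snd v) *\<^sub>R w1 (fst q),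
       snd (snd q) *\<^sub>R (fst v *\<^sub>R (l2 * cis (- \<alpha> s) * cnj (w1 s))) + snd (snd v) *\<^sub>R w2 (fst q),
       (C / 2 * Im (cis (\<alpha> s) * w1 s * w2 s)) * fst v))) (at q)"
    unfolding F
    by (intro has_derivative_Pair has_derivative_scaleR c has_derivative_compose[OF c(1) w(1)]
        has_derivative_compose[OF c(1) w(2)] has_derivative_compose[OF c(1) w(3)])
  moreover have "(\<lambda>v.
      (fst (snd q) *\<^sub>R (fst v *\<^sub>R (l1 * cis (- \<alpha> s) * cnj (w2 s))) + fst (snd v) *\<^sub>R w1 (fst q),
       snd (snd q) *\<^sub>R (fst v *\<^sub>R (l2 * cis (- \<alpha> s) * cnj (w1 s))) + snd (snd v) *\<^sub>R w2 (fst q),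
       (C / 2 * Im (cis (\<alpha> s) * w1 s * w2 s)) * fst v)) = dF q"
    by (auto simp: q)
  ultimately show ?thesis by simp
qed

text \<open>The tangent plane of \<open>M\<close>, parametrised by the speed \<open>s'\<close> and
  the multiple \<open>c\<close> of \<open>(- l2 y, l1 x)\<close>, the direction annihilated by the
  differential of the conic equation.\<close>

definition tangent :: "real \<times> real \<times> real \<Rightarrow> (real \<times> real \<times> real) set" where
  "tangent = (\<lambda>(s, x, y). {(s', - l2 * y * c, l1 * x * c) | s' c. True})"

text \<open>Since \<open>C\<close> is nonzero the conic avoids the origin, so one of the coordinates
  can be divided by.\<close>

lemma tangentI:
  assumes "(s, x, y) \<in> M" "l1 * x * x' + l2 * y * y' = 0"
  shows "(s', x', y') \<in> tangent (s, x, y)"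
proof -
  have "x \<noteq> 0 \<or> y \<noteq> 0"
    using assms(1) nonzero by (auto simp: conic_surface_def)
  then have "\<exists>c. x' = - l2 * y * c \<and> y' = l1 * x * c"
  proof
    assume "x \<noteq> 0"
    then show ?thesis
      using assms(2) nonzero by (intro exI[of _ "y' / (l1 * x)"]) (simp add: field_simps)
  next
    assume "y \<noteq> 0"
    then show ?thesis
      using assms(2) nonzero by (intro exI[of _ "- x' / (l2 * y)"]) (simp add: field_simps)
  qed
  then show ?thesis by (auto simp: tangent_def)
qed

definition weight :: "real \<times> real \<times> real \<Rightarrow> real" where
  "weight = (\<lambda>(s, x, y). ((l1 * x * cmod (w2 s))\<^sup>2 + (l2 * y * cmod (w1 s))\<^sup>2) / 4)"

lemma weight_pos:
  assumes "q \<in> M"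
  shows "weight q > 0"
proof -
  obtain s x y where q: "q = (s, x, y)" "s \<in> I" "l1 * x\<^sup>2 + l2 * y\<^sup>2 = C"
    using assms by (auto simp: conic_surface_def)
  from q(3) nonzero(3) have "x \<noteq> 0 \<or> y \<noteq> 0" by auto
  then show ?thesis
    using nonzero w_nonzero[OF q(2)] by (auto simp: q(1) weight_def add_pos_nonneg add_nonneg_pos)
qed

text \<open>The \<open>s\<close>-direction maps to \<open>cis (- \<alpha> s)\<close> times
  \<open>(l1 x cnj w2, l2 y cnj w1)\<close>, the conic direction to
  \<open>(- l2 y w1, l1 x w2)\<close>. In the determinant conjugates meet and leave squared moduli,
  collected in \<open>weight\<close>; so \<open>\<alpha>\<close> is the Legendre angle.\<close>

lemma Omega_T_dF:
  "Omega_T (dF (s, x, y) (s', - l2 * y * c, l1 * x * c)) (dF (s, x, y) (t', - l2 * y * d, l1 * x * d))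
     = of_real ((s' * d - t' * c) * weight (s, x, y)) * cis (- \<alpha> s)"
proof -
  define e where "e = cis (- \<alpha> s)"
  have W: "complex_of_real (weight (s, x, y))
      = ((l1 * x)\<^sup>2 * (w2 s * cnj (w2 s)) + (l2 * y)\<^sup>2 * (w1 s * cnj (w1 s))) / 4"
    by (simp add: weight_def power_mult_distrib complex_norm_square[symmetric])
  show ?thesis
    by (simp add: e_def[symmetric] W scaleR_conv_of_real power2_eq_square field_simps)
qed

text \<open>The conic direction moves each complex coordinate by a real multiple of
  \<open>w1\<close> or \<open>w2\<close>, invisible to \<open>symp\<close>. In the
  \<open>s\<close>-direction the conic equation produces the factor \<open>C\<close>, and the
  equation for \<open>z\<close> balances it.\<close>

lemma eta_dF:
  assumes "q \<in> M" "v \<in> tangent q"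
  shows "eta (F q) (dF q v) = 0"
proof -
  obtain s x y where q: "q = (s, x, y)" "l1 * x\<^sup>2 + l2 * y\<^sup>2 = C"
    using assms(1) by (auto simp: conic_surface_def)
  obtain s' c where v: "v = (s', - l2 * y * c, l1 * x * c)"
    using assms(2) by (auto simp: q(1) tangent_def)
  define m where "m = Im (cis (\<alpha> s) * w1 s * w2 s)"
  have "symp (F q) (dF q v) = - (s' * (l1 * x\<^sup>2 + l2 * y\<^sup>2) * m)"
    unfolding q(1) v m_def by (simp add: conic_map_def power2_eq_square algebra_simps)
  moreover have "snd (snd (dF q v)) = s' * (C / 2 * m)"
    unfolding q(1) v m_def by simp
  ultimately show ?thesis
    unfolding eta_eq_symp q(2) by simp
qed

text \<open>On the tangent plane the pulled-back \<open>Omega_T\<close> is a nonzero multiple of an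
  area form, hence nondegenerate.\<close>

lemma dF_inj:
  assumes "q \<in> M" "v \<in> tangent q" "dF q v = 0"
  shows "v = 0"
proof -
  obtain s x y where q: "q = (s, x, y)"
    by (cases q)
  obtain s' c where v: "v = (s', - l2 * y * c, l1 * x * c)"
    using assms(2) by (auto simp: q tangent_def)
  have "Omega_T (dF q v) (dF q (t', - l2 * y * d, l1 * x * d)) = 0" for t' d
    unfolding assms(3) by (rule Omega_T.zero_left)
  then have "(s' * d - t' * c) * weight q = 0" for t' d
    unfolding q v Omega_T_dF by (metis cis_neq_zero mult_eq_0_iff of_real_eq_0_iff)
  then have "s' * d - t' * c = 0" for t' d
    using weight_pos[OF assms(1)] by (metis less_irrefl mult_eq_0_iff)
  from this[of 1 0] this[of 0 1] have "s' = 0" "c = 0" by simp_all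
  then show ?thesis by (simp add: v zero_prod_def)
qed

text \<open>Insensitive to orientation, hence usable in every chart, as the soliton equation
  demands.\<close>

lemma Omega_T_dF_angle:
  assumes "v \<in> tangent q" "v' \<in> tangent q"
  shows "Im (Omega_T (dF q v) (dF q v') * cis (\<alpha> (fst q))) = 0"
proof -
  obtain s x y where q: "q = (s, x, y)"
    by (cases q)
  obtain s' c t' d where v: "v = (s', - l2 * y * c, l1 * x * c)" "v' = (t', - l2 * y * d, l1 * x * d)"
    using assms by (auto simp: q tangent_def)
  show ?thesis
    unfolding q v Omega_T_dF by (simp add: mult.assoc cis_mult del: of_real_mult of_real_diff)
qed

section \<open>The immersion read in an arbitrary chart\<close>

context
  fixes U :: "(real \<times> real) set" and \<psi> :: "real \<times> real \<Rightarrow> real \<times> real \<times> real"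
  assumes chart: "surface_chart M U \<psi>"
begin

lemma chart_open: "open U"
  and chart_smooth: "smooth_on U \<psi>"
  and chart_inj: "p \<in> U \<Longrightarrow> inj (frechet_derivative \<psi> (at p))"
  and chart_in: "p \<in> U \<Longrightarrow> \<psi> p \<in> M"
  using chart by (auto simp: surface_chart_def)

lemma has_derivative_chart: "p \<in> U \<Longrightarrow> (\<psi> has_derivative frechet_derivative \<psi> (at p)) (at p)"
  by (rule smooth_onD(1)[OF chart_smooth])

lemma chart_tangent:
  assumes p: "p \<in> U"
  shows "frechet_derivative \<psi> (at p) v \<in> tangent (\<psi> p)"
proof -
  let ?x = "\<lambda>p. fst (snd (\<psi> p))" and ?y = "\<lambda>p. snd (snd (\<psi> p))"
  let ?D = "frechet_derivative \<psi> (at p)"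
  have zero: "l1 * (?x q * ?x q) + l2 * (?y q * ?y q) - C = 0" if "q \<in> U" for q
    using chart_in[OF that] by (auto simp: conic_surface_def power2_eq_square)
  have "((\<lambda>q. l1 * (?x q * ?x q) + l2 * (?y q * ?y q) - C) has_derivative
      (\<lambda>v. l1 * (?x p * fst (snd (?D v)) + fst (snd (?D v)) * ?x p)
         + l2 * (?y p * snd (snd (?D v)) + snd (snd (?D v)) * ?y p) - 0)) (at p)"
    by (intro derivative_intros has_derivative_chart p)
  from derivative_of_zero[OF chart_open p zero this, of v]
  have "l1 * ?x p * fst (snd (?D v)) + l2 * ?y p * snd (snd (?D v)) = 0"
    by (simp add: algebra_simps)
  then have "(fst (?D v), fst (snd (?D v)), snd (snd (?D v))) \<in> tangent (fst (\<psi> p), ?x p, ?y p)"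
    using chart_in[OF p] by (intro tangentI) simp_all
  then show ?thesis by simp
qed

lemma frechet_derivative_F_chart:
  assumes "p \<in> U"
  shows "frechet_derivative (F \<circ> \<psi>) (at p) = (\<lambda>v. dF (\<psi> p) (frechet_derivative \<psi> (at p) v))"
proof -
  have "(F \<circ> \<psi> has_derivative (\<lambda>v. dF (\<psi> p) (frechet_derivative \<psi> (at p) v))) (at p)"
    unfolding comp_def
    by (rule has_derivative_compose[OF has_derivative_chart has_derivative_F[OF chart_in]];
        rule assms)
  from frechet_derivative_at[OF this] show ?thesis by simp
qed

lemma smooth_F_chart: "smooth_on U (F \<circ> \<psi>)"
proof -
  have "F \<circ> \<psi> = (\<lambda>p. (fst (snd (\<psi> p)) *\<^sub>R w1 (fst (\<psi> p)), snd (snd (\<psi> p)) *\<^sub>R w2 (fst (\<psi> p)), z (fst (\<psi> p))))"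
    by (auto simp: conic_map_def scaleR_conv_of_real split: prod.split)
  moreover have "(\<lambda>p. fst (\<psi> p)) ` U \<subseteq> I"
    using chart_in by (force simp: conic_surface_def)
  ultimately show ?thesis
    by (simp only:) (intro smooth_on_Pair smooth_on_scaleR smooth_on_fst smooth_on_snd chart_open
        chart_smooth smooth_on_compose_real[OF chart_open smooth(1)]
        smooth_on_compose_real[OF chart_open smooth(2)] smooth_on_compose_real[OF chart_open smooth(3)])
qed

lemma legendrian_patch_chart: "legendrian_patch U (F \<circ> \<psi>)"
proof
  show "open U" by (rule chart_open)
  show "smooth_on U (F \<circ> \<psi>)" by (rule smooth_F_chart)
  fix p assume p: "p \<in> U"
  show "eta ((F \<circ> \<psi>) p) (frechet_derivative (F \<circ> \<psi>) (at p) v) = 0" for v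
    using eta_dF[OF chart_in chart_tangent] p by (simp add: frechet_derivative_F_chart)
  have lin: "linear (frechet_derivative (F \<circ> \<psi>) (at p))"
    using smooth_onD(1)[OF smooth_F_chart p] has_derivative_linear by blast
  have lin': "linear (frechet_derivative \<psi> (at p))"
    using has_derivative_chart[OF p] has_derivative_linear by blast
  have "v = 0" if "frechet_derivative (F \<circ> \<psi>) (at p) v = 0" for v
  proof -
    have "frechet_derivative \<psi> (at p) v = 0"
      using dF_inj[OF chart_in[OF p] chart_tangent[OF p]] that p by (simp add: frechet_derivative_F_chart)
    then show ?thesis
      using chart_inj[OF p] lin' linear_injective_0 by blast
  qed
  then show "inj (frechet_derivative (F \<circ> \<psi>) (at p))"
    using lin linear_injective_0 by blast
qed

end

text \<open>Projecting the conic from \<open>(-a, -b)\<close> parametrises it rationally; the parameter \<open>t\<close> is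
  chosen so that \<open>t = 0\<close> is the point \<open>(a, b)\<close>.\<close>

definition conic_chart :: "real \<Rightarrow> real \<Rightarrow> real \<times> real \<Rightarrow> real \<times> real \<times> real" where
  "conic_chart a b = (\<lambda>(s, t). (s,
     ((1 - l1 * l2 * t\<^sup>2) * a - 2 * t * l2 * b) / (1 + l1 * l2 * t\<^sup>2),
     ((1 - l1 * l2 * t\<^sup>2) * b + 2 * t * l1 * a) / (1 + l1 * l2 * t\<^sup>2)))"

text \<open>For \<open>l1 * l2 > 0\<close> every \<open>t\<close> is allowed and the ellipse loses
  only the point \<open>(-a, -b)\<close>; for \<open>l1 * l2 < 0\<close> the condition selects the
  branch of the hyperbola through \<open>(a, b)\<close>.\<close>

definition chart_domain :: "(real \<times> real) set" where
  "chart_domain = I \<times> {t. 1 + l1 * l2 * t\<^sup>2 > 0}"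

lemma open_chart_domain: "open chart_domain"
  unfolding chart_domain_def
  by (intro open_Times open_I open_Collect_less continuous_intros)

lemma smooth_conic_chart: "smooth_on chart_domain (conic_chart a b)"
proof -
  have "conic_chart a b = (\<lambda>p. (fst p,
     ((1 + (- 1) * (l1 * l2 * (snd p * snd p))) * a + (- 2) * (snd p * (l2 * b))) / (1 + l1 * l2 * (snd p * snd p)),
     ((1 + (- 1) * (l1 * l2 * (snd p * snd p))) * b + 2 * (snd p * (l1 * a))) / (1 + l1 * l2 * (snd p * snd p))))"
    by (auto simp: conic_chart_def power2_eq_square)
  moreover have "1 + l1 * l2 * (snd p * snd p) \<noteq> 0" if "p \<in> chart_domain" for p
    using that by (auto simp: chart_domain_def power2_eq_square)
  ultimately show ?thesis
    by (simp only:) (intro smooth_on_Pair smooth_on_divide smooth_on_add smooth_on_mult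
        smooth_on_fst smooth_on_snd smooth_on_id smooth_on_const open_chart_domain)
qed

text \<open>Expressed at the image point, the \<open>t\<close>-derivative has the shape used in
  \<open>tangent\<close>, with a positive factor. This gives these charts the orientation required
  for the Legendre angle.\<close>

lemma has_derivative_conic_chart:
  assumes "(s, t) \<in> chart_domain" "conic_chart a b (s, t) = (s, x, y)"
  shows "(conic_chart a b has_derivative
    (\<lambda>(s', t'). (s', - l2 * y * (2 / (1 + l1 * l2 * t\<^sup>2) * t'), l1 * x * (2 / (1 + l1 * l2 * t\<^sup>2) * t'))))
    (at (s, t))"
proof -
  let ?n = "\<lambda>t. 1 + l1 * l2 * t\<^sup>2"
  have n: "?n t \<noteq> 0" using assms(1) by (auto simp: chart_domain_def)
  have x: "x * ?n t = (1 - l1 * l2 * t\<^sup>2) * a - 2 * t * l2 * b"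
    and y: "y * ?n t = (1 - l1 * l2 * t\<^sup>2) * b + 2 * t * l1 * a"
    using assms(2) n by (auto simp: conic_chart_def)
  have "((\<lambda>t. ((1 - l1 * l2 * t\<^sup>2) * a - 2 * t * l2 * b) / ?n t) has_real_derivative
      ((- (2 * l1 * l2 * t) * a - 2 * l2 * b) * ?n t
        - ((1 - l1 * l2 * t\<^sup>2) * a - 2 * t * l2 * b) * (2 * l1 * l2 * t)) / (?n t * ?n t)) (at t)"
    by (rule derivative_eq_intros refl n | simp)+
  also have "((- (2 * l1 * l2 * t) * a - 2 * l2 * b) * ?n t
        - ((1 - l1 * l2 * t\<^sup>2) * a - 2 * t * l2 * b) * (2 * l1 * l2 * t)) / (?n t * ?n t)
      = (- l2 * (y * ?n t) * 2) / (?n t * ?n t)"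
    unfolding y by (simp add: algebra_simps power2_eq_square)
  also have "\<dots> = - l2 * y * (2 / ?n t)" using n by simp
  finally have dx: "((\<lambda>t. ((1 - l1 * l2 * t\<^sup>2) * a - 2 * t * l2 * b) / ?n t) has_real_derivative
      - l2 * y * (2 / ?n t)) (at t)" .
  have "((\<lambda>t. ((1 - l1 * l2 * t\<^sup>2) * b + 2 * t * l1 * a) / ?n t) has_real_derivative
      ((- (2 * l1 * l2 * t) * b + 2 * l1 * a) * ?n t
        - ((1 - l1 * l2 * t\<^sup>2) * b + 2 * t * l1 * a) * (2 * l1 * l2 * t)) / (?n t * ?n t)) (at t)"
    by (rule derivative_eq_intros refl n | simp)+
  also have "((- (2 * l1 * l2 * t) * b + 2 * l1 * a) * ?n t
        - ((1 - l1 * l2 * t\<^sup>2) * b + 2 * t * l1 * a) * (2 * l1 * l2 * t)) / (?n t * ?n t)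
      = (l1 * (x * ?n t) * 2) / (?n t * ?n t)"
    unfolding x by (simp add: algebra_simps power2_eq_square)
  also have "\<dots> = l1 * x * (2 / ?n t)" using n by simp
  finally have dy: "((\<lambda>t. ((1 - l1 * l2 * t\<^sup>2) * b + 2 * t * l1 * a) / ?n t) has_real_derivative
      l1 * x * (2 / ?n t)) (at t)" .
  have snd: "(snd has_derivative snd) (at (s, t))" and fst: "(fst has_derivative fst) (at (s, t))"
    by (auto intro!: derivative_eq_intros)
  have at: "(g has_derivative (*) d) (at (snd (s, t)))" if "(g has_real_derivative d) (at t)" for g d
    using that by (simp add: has_field_derivative_def)
  have "((\<lambda>p. (fst p, ((1 - l1 * l2 * (snd p)\<^sup>2) * a - 2 * snd p * l2 * b) / ?n (snd p),
       ((1 - l1 * l2 * (snd p)\<^sup>2) * b + 2 * snd p * l1 * a) / ?n (snd p))) has_derivative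
     (\<lambda>v. (fst v, - l2 * y * (2 / ?n t) * snd v, l1 * x * (2 / ?n t) * snd v))) (at (s, t))"
    by (intro has_derivative_Pair fst has_derivative_compose[OF snd at[OF dx]]
        has_derivative_compose[OF snd at[OF dy]])
  then show ?thesis
    by (simp add: conic_chart_def case_prod_unfold mult.assoc)
qed

text \<open>The first equation rests on \<open>(1 - k)^2 + 4 k = (1 + k)^2\<close> for
  \<open>k = l1 l2 t^2\<close>. The quotient of the other two recovers \<open>t\<close>, whence the
  formula of \<open>chart_inverse\<close>.\<close>

lemma conic_chart_eqs:
  assumes "l1 * a\<^sup>2 + l2 * b\<^sup>2 = C" "(s, t) \<in> chart_domain" "conic_chart a b (s, t) = (s, x, y)"
  shows "l1 * x\<^sup>2 + l2 * y\<^sup>2 = C"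
    and "l1 * a * x + l2 * b * y + C = 2 * C / (1 + l1 * l2 * t\<^sup>2)"
    and "a * y - b * x = 2 * t * C / (1 + l1 * l2 * t\<^sup>2)"
proof -
  let ?n = "1 + l1 * l2 * t\<^sup>2"
  have n: "?n \<noteq> 0" using assms(2) by (auto simp: chart_domain_def)
  have x: "x = ((1 - l1 * l2 * t\<^sup>2) * a - 2 * t * l2 * b) / ?n"
    and y: "y = ((1 - l1 * l2 * t\<^sup>2) * b + 2 * t * l1 * a) / ?n"
    using assms(3) by (auto simp: conic_chart_def)
  have "l1 * x\<^sup>2 + l2 * y\<^sup>2 = (l1 * ((1 - l1 * l2 * t\<^sup>2) * a - 2 * t * l2 * b)\<^sup>2
      + l2 * ((1 - l1 * l2 * t\<^sup>2) * b + 2 * t * l1 * a)\<^sup>2) / ?n\<^sup>2"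
    by (simp only: x y power_divide times_divide_eq_right add_divide_distrib[symmetric])
  also have "\<dots> = ?n\<^sup>2 * (l1 * a\<^sup>2 + l2 * b\<^sup>2) / ?n\<^sup>2"
    by (simp add: algebra_simps power2_eq_square)
  finally show "l1 * x\<^sup>2 + l2 * y\<^sup>2 = C" using n assms(1) by simp
  have "l1 * a * x + l2 * b * y = (l1 * a * ((1 - l1 * l2 * t\<^sup>2) * a - 2 * t * l2 * b)
      + l2 * b * ((1 - l1 * l2 * t\<^sup>2) * b + 2 * t * l1 * a)) / ?n"
    by (simp only: x y times_divide_eq_right add_divide_distrib[symmetric])
  also have "\<dots> = (1 - l1 * l2 * t\<^sup>2) * (l1 * a\<^sup>2 + l2 * b\<^sup>2) / ?n"
    by (simp add: algebra_simps power2_eq_square)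
  finally show "l1 * a * x + l2 * b * y + C = 2 * C / ?n"
    unfolding assms(1) using n by (simp add: field_simps)
  have "a * y - b * x = (a * ((1 - l1 * l2 * t\<^sup>2) * b + 2 * t * l1 * a)
      - b * ((1 - l1 * l2 * t\<^sup>2) * a - 2 * t * l2 * b)) / ?n"
    by (simp only: x y times_divide_eq_right diff_divide_distrib[symmetric])
  also have "\<dots> = 2 * t * (l1 * a\<^sup>2 + l2 * b\<^sup>2) / ?n"
    by (simp add: algebra_simps power2_eq_square)
  finally show "a * y - b * x = 2 * t * C / ?n" unfolding assms(1) .
qed

definition chart_inverse :: "real \<Rightarrow> real \<Rightarrow> real \<times> real \<times> real \<Rightarrow> real \<times> real" where
  "chart_inverse a b = (\<lambda>(s, x, y). (s, (a * y - b * x) / (l1 * a * x + l2 * b * y + C)))"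

lemma chart_inverse_left:
  assumes "l1 * a\<^sup>2 + l2 * b\<^sup>2 = C" "p \<in> chart_domain"
  shows "chart_inverse a b (conic_chart a b p) = p"
proof -
  obtain s t where p: "p = (s, t)" by (cases p)
  obtain x y where xy: "conic_chart a b (s, t) = (s, x, y)" by (auto simp: conic_chart_def)
  have "1 + l1 * l2 * t\<^sup>2 \<noteq> 0" using assms(2) by (auto simp: chart_domain_def p)
  then show ?thesis
    unfolding p xy using nonzero
    by (simp add: chart_inverse_def conic_chart_eqs(2,3)[OF assms(1) assms(2)[unfolded p] xy])
qed

text \<open>By the Lagrange identity for the form \<open>l1 x^2 + l2 y^2\<close>, the candidate
  \<open>t = k / d\<close> satisfies \<open>1 + l1 l2 t^2 = 2 C / d\<close>. Positivity of
  \<open>d / C\<close> is thus exactly membership in the chart domain.\<close>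

lemma chart_inverse_right:
  assumes ab: "l1 * a\<^sup>2 + l2 * b\<^sup>2 = C" and M: "(s, x, y) \<in> M"
    and pos: "(l1 * a * x + l2 * b * y + C) / C > 0"
  shows "chart_inverse a b (s, x, y) \<in> chart_domain"
    and "conic_chart a b (chart_inverse a b (s, x, y)) = (s, x, y)"
proof -
  have s: "s \<in> I" and xy: "l1 * x\<^sup>2 + l2 * y\<^sup>2 = C" using M by (auto simp: conic_surface_def)
  define d where "d = l1 * a * x + l2 * b * y + C"
  define k where "k = a * y - b * x"
  have d: "d \<noteq> 0" "C / d > 0" using pos by (auto simp: d_def zero_less_divide_iff)
  have "(d - C)\<^sup>2 + l1 * l2 * k\<^sup>2 = (l1 * a\<^sup>2 + l2 * b\<^sup>2) * (l1 * x\<^sup>2 + l2 * y\<^sup>2)"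
    unfolding d_def k_def by (simp add: algebra_simps power2_eq_square)
  then have k2: "l1 * l2 * k\<^sup>2 = 2 * C * d - d\<^sup>2"
    unfolding ab xy by (simp add: power2_eq_square algebra_simps)
  have "l1 * l2 * (k / d)\<^sup>2 = (l1 * l2 * k\<^sup>2) / d\<^sup>2" by (simp add: power_divide)
  also have "\<dots> = 2 * C / d - 1" unfolding k2 using d(1) by (simp add: field_simps power2_eq_square)
  finally have t: "l1 * l2 * (k / d)\<^sup>2 = 2 * C / d - 1" .
  have inv: "chart_inverse a b (s, x, y) = (s, k / d)"
    by (simp add: chart_inverse_def k_def d_def)
  show "chart_inverse a b (s, x, y) \<in> chart_domain"
    unfolding inv chart_domain_def using s d t by simp
  have "conic_chart a b (s, k / d) = (s, (a * (d - C) - l2 * b * k) / C, (b * (d - C) + l1 * a * k) / C)"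
    unfolding conic_chart_def prod.case t using nonzero d(1) by (simp add: field_simps)
  moreover have "a * (d - C) - l2 * b * k = (l1 * a\<^sup>2 + l2 * b\<^sup>2) * x"
    "b * (d - C) + l1 * a * k = (l1 * a\<^sup>2 + l2 * b\<^sup>2) * y"
    by (simp_all add: d_def k_def power2_eq_square algebra_simps)
  ultimately show "conic_chart a b (chart_inverse a b (s, x, y)) = (s, x, y)"
    unfolding inv using nonzero ab by simp
qed

lemma surface_chart_conic:
  assumes ab: "l1 * a\<^sup>2 + l2 * b\<^sup>2 = C"
  shows "surface_chart M chart_domain (conic_chart a b)"
proof -
  \<comment> \<open>The image is cut out of \<open>M\<close> by an open half-space, hence relatively
    open.\<close>
  let ?V = "{q. (l1 * a * fst (snd q) + l2 * b * snd (snd q) + C) / C > 0} :: (real \<times> real \<times> real) set"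
  have image: "conic_chart a b ` chart_domain = M \<inter> ?V"
  proof (intro set_eqI iffI)
    fix q assume "q \<in> conic_chart a b ` chart_domain"
    then obtain s t where p: "(s, t) \<in> chart_domain" "q = conic_chart a b (s, t)" by auto
    obtain x y where xy: "conic_chart a b (s, t) = (s, x, y)" by (auto simp: conic_chart_def)
    show "q \<in> M \<inter> ?V"
      using conic_chart_eqs(1,2)[OF ab p(1) xy] p nonzero
      by (auto simp: xy conic_surface_def chart_domain_def)
  next
    fix q assume q: "q \<in> M \<inter> ?V"
    obtain s x y where "q = (s, x, y)" by (cases q)
    then show "q \<in> conic_chart a b ` chart_domain"
      using chart_inverse_right[OF ab, of s x y] q by (intro rev_image_eqI[of "chart_inverse a b q"]) auto
  qed
  have openV: "open ?V"
    using nonzero by (intro open_Collect_less continuous_intros) auto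
  have inj: "inj (frechet_derivative (conic_chart a b) (at p))" if p: "p \<in> chart_domain" for p
  proof -
    obtain s t where st: "p = (s, t)" by (cases p)
    obtain x y where xy: "conic_chart a b (s, t) = (s, x, y)" by (auto simp: conic_chart_def)
    have eq: "frechet_derivative (conic_chart a b) (at p) = (\<lambda>(s', t').
        (s', - l2 * y * (2 / (1 + l1 * l2 * t\<^sup>2) * t'), l1 * x * (2 / (1 + l1 * l2 * t\<^sup>2) * t')))"
      using frechet_derivative_at[OF has_derivative_conic_chart[OF p[unfolded st] xy]] by (simp add: st)
    have n: "1 + l1 * l2 * t\<^sup>2 \<noteq> 0" using p by (auto simp: chart_domain_def st)
    have "x \<noteq> 0 \<or> y \<noteq> 0"
      using conic_chart_eqs(1)[OF ab p[unfolded st] xy] nonzero by auto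
    then show ?thesis
      unfolding eq using nonzero n by (auto intro!: injI)
  qed
  have "homeomorphism chart_domain (conic_chart a b ` chart_domain) (conic_chart a b) (chart_inverse a b)"
  proof (rule homeomorphismI)
    show "continuous_on chart_domain (conic_chart a b)"
      by (rule smooth_onD(3)[OF smooth_conic_chart])
    have "l1 * a * fst (snd q) + l2 * b * snd (snd q) + C \<noteq> 0" if "q \<in> conic_chart a b ` chart_domain" for q
      using that unfolding image by auto
    then show "continuous_on (conic_chart a b ` chart_domain) (chart_inverse a b)"
      unfolding chart_inverse_def case_prod_unfold by (intro continuous_intros) auto
    show "chart_inverse a b ` conic_chart a b ` chart_domain \<subseteq> chart_domain"
      using chart_inverse_left[OF ab] by auto
  qed (use chart_inverse_left[OF ab] in auto)
  then show ?thesis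
    unfolding surface_chart_def
    using open_chart_domain smooth_conic_chart inj image openin_open_Int[OF openV, of M] by auto
qed

section \<open>Immersion, Legendre angle and soliton equation of the conic surface\<close>

lemma legendrian_immersion_F: "legendrian_immersion M F"
  and legendre_angle_F: "legendre_angle M F (\<lambda>(s, x, y). \<alpha> s)"
proof -
  \<comment> \<open>The chart centred at a point reaches it at \<open>t = 0\<close>.\<close>
  have in_chart: "(s, a, b) \<in> conic_chart a b ` chart_domain" if "s \<in> I" for s a b
    using that by (intro rev_image_eqI[of "(s, 0)"]) (auto simp: chart_domain_def conic_chart_def)
  have emb: "embedded_surface M"
    unfolding embedded_surface_def
  proof
    fix q assume "q \<in> M"
    then obtain s a b where q: "q = (s, a, b)" "s \<in> I" "l1 * a\<^sup>2 + l2 * b\<^sup>2 = C"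
      by (auto simp: conic_surface_def)
    then show "\<exists>U \<psi>. surface_chart M U \<psi> \<and> q \<in> \<psi> ` U"
      using surface_chart_conic[OF q(3)] in_chart by blast
  qed
  show "legendrian_immersion M F"
    unfolding legendrian_immersion_def immersed_surface_def
    using emb legendrian_patch.smooth_f[OF legendrian_patch_chart]
      legendrian_patch.inj_D[OF legendrian_patch_chart] legendrian_patch.eta_D[OF legendrian_patch_chart]
    by auto
  have "continuous_on M (\<lambda>q. \<alpha> (fst q))"
    by (rule continuous_on_compose2[OF smooth_onD(3)[OF smooth(4)]])
      (auto simp: conic_surface_def intro: continuous_intros)
  then have cont: "continuous_on M (\<lambda>(s, x, y). \<alpha> s)"
    by (simp add: case_prod_unfold)
  have angle: "Omega_T (frechet_derivative (F \<circ> conic_chart a b) (at p) (1,0))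
        (frechet_derivative (F \<circ> conic_chart a b) (at p) (0,1))
      = cis (- \<alpha> (fst (conic_chart a b p)))
          * of_real (sqrt (gram_det sasaki_metric (F \<circ> conic_chart a b) p))"
    if ab: "l1 * a\<^sup>2 + l2 * b\<^sup>2 = C" and p: "p \<in> chart_domain" for a b p
  proof -
    obtain s t where st: "p = (s, t)" by (cases p)
    obtain x y where xy: "conic_chart a b (s, t) = (s, x, y)" by (auto simp: conic_chart_def)
    note chart = surface_chart_conic[OF ab]
    define m where "m = 2 / (1 + l1 * l2 * t\<^sup>2)"
    have m: "m > 0" using p by (auto simp: st chart_domain_def m_def)
    have "frechet_derivative (conic_chart a b) (at p) =
        (\<lambda>(s', t'). (s', - l2 * y * (m * t'), l1 * x * (m * t')))"
      using frechet_derivative_at[OF has_derivative_conic_chart[OF p[unfolded st] xy]]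
      by (simp add: st m_def)
    \<comment> \<open>The coordinate vectors are written with \<open>c = 0\<close> and
      \<open>c = m\<close> to fit \<open>Omega_T_dF\<close>.\<close>
    then have d: "frechet_derivative (F \<circ> conic_chart a b) (at p) (1,0) = dF (s, x, y) (1, - l2 * y * 0, l1 * x * 0)"
      "frechet_derivative (F \<circ> conic_chart a b) (at p) (0,1) = dF (s, x, y) (0, - l2 * y * m, l1 * x * m)"
      using frechet_derivative_F_chart[OF chart p] by (simp_all add: st xy)
    let ?w = "m * weight (s, x, y)"
    have w: "?w > 0"
      using weight_pos[OF chart_in[OF chart p]] m by (simp add: st xy)
    have O: "Omega_T (frechet_derivative (F \<circ> conic_chart a b) (at p) (1,0))
        (frechet_derivative (F \<circ> conic_chart a b) (at p) (0,1)) = of_real ?w * cis (- \<alpha> s)"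
      unfolding d Omega_T_dF by simp
    have "gram_det sasaki_metric (F \<circ> conic_chart a b) p = ?w\<^sup>2"
      unfolding legendrian_patch.gram_det_eq[OF legendrian_patch_chart[OF chart] p] O
      using w by (simp add: norm_mult abs_mult power_mult_distrib)
    then show ?thesis
      unfolding O using w by (simp add: st xy mult.commute)
  qed
  show "legendre_angle M F (\<lambda>(s, x, y). \<alpha> s)"
    unfolding legendre_angle_def
  proof (intro conjI cont ballI)
    fix q assume "q \<in> M"
    then obtain s a b where q: "q = (s, a, b)" "s \<in> I" "l1 * a\<^sup>2 + l2 * b\<^sup>2 = C"
      by (auto simp: conic_surface_def)
    show "\<exists>U \<psi>. surface_chart M U \<psi> \<and> q \<in> \<psi> ` U \<and>
        (\<forall>p\<in>U. Omega_T (frechet_derivative (F \<circ> \<psi>) (at p) (1,0)) (frechet_derivative (F \<circ> \<psi>) (at p) (0,1))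
          = cis (- (case \<psi> p of (s, x, y) \<Rightarrow> \<alpha> s)) * of_real (sqrt (gram_det sasaki_metric (F \<circ> \<psi>) p)))"
      using surface_chart_conic[OF q(3)] in_chart[OF q(2)] angle[OF q(3)]
      by (intro exI[of _ chart_domain] exI[of _ "conic_chart a b"]) (simp add: q(1) case_prod_unfold)
  qed
qed

text \<open>The hypothesis says that the angle is \<open>\<theta> - a z / 2\<close>, so
  \<open>soliton_of_angle\<close> applies; its Reeb coefficient \<open>a z\<close> equals
  \<open>- 2 (\<alpha> - \<theta>)\<close>.\<close>

lemma soliton_equation_F:
  assumes "\<And>s. s \<in> I \<Longrightarrow> \<alpha> s + a / 2 * z s = \<theta>"
  shows "soliton_equation M F (\<lambda>(s, x, y). \<alpha> s - \<theta>) a"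
  unfolding soliton_equation_def
proof (intro allI impI ballI)
  fix U \<psi> p assume chart: "surface_chart M U \<psi>" and p: "p \<in> U"
  interpret legendrian_patch U "F \<circ> \<psi>" by (rule legendrian_patch_chart[OF chart])
  have I: "fst (\<psi> q) \<in> I" if "q \<in> U" for q
    using chart_in[OF chart that] by (auto simp: conic_surface_def)
  have z: "snd (snd ((F \<circ> \<psi>) q)) = z (fst (\<psi> q))" for q
    by (simp add: conic_map_def case_prod_unfold)
  have "Im (Omega_T (D q (1,0)) (D q (0,1)) * cis (\<theta> - a / 2 * snd (snd ((F \<circ> \<psi>) q)))) = 0"
    if q: "q \<in> U" for q
  proof -
    have "\<theta> - a / 2 * snd (snd ((F \<circ> \<psi>) q)) = \<alpha> (fst (\<psi> q))"
      unfolding z using assms[OF I[OF q]] by simp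
    then show ?thesis
      using Omega_T_dF_angle[OF chart_tangent[OF chart q] chart_tangent[OF chart q]]
      by (simp only: frechet_derivative_F_chart[OF chart q])
  qed
  from soliton_of_angle[OF p this]
  have "mean_curvature sasaki_metric (F \<circ> \<psi>) p + (a * z (fst (\<psi> p))) *\<^sub>R reeb
      = a *\<^sub>R normal_part sasaki_metric (F \<circ> \<psi>) p (dilation_field (F (\<psi> p)))"
    unfolding z by simp
  moreover have "a * z (fst (\<psi> p)) = - (2 * (\<alpha> (fst (\<psi> p)) - \<theta>))"
    using assms[OF I[OF p]] by (simp add: field_simps)
  ultimately show "mean_curvature sasaki_metric (F \<circ> \<psi>) p
      - (2 * (case \<psi> p of (s, x, y) \<Rightarrow> \<alpha> s - \<theta>)) *\<^sub>R reeb
      = a *\<^sub>R normal_part sasaki_metric (F \<circ> \<psi>) p (dilation_field (F (\<psi> p)))"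
    by (simp only: case_prod_unfold scaleR_minus_left diff_conv_add_uminus)
qed

end

section \<open>From the polar system to the geometric conclusions\<close>

theorem theorem1p1:
  fixes l1 l2 C a s0 \<rho>1 \<rho>2 :: real
    and I :: "real set"
    and \<alpha> z \<phi>1 \<phi>2 \<phi> r1 r2 u Q :: "real \<Rightarrow> real"
    and w1 w2 :: "real \<Rightarrow> complex"
    and M :: "(real \<times> real \<times> real) set"
    and F :: "real \<times> real \<times> real \<Rightarrow> complex \<times> complex \<times> real"
    and L :: "(complex \<times> complex \<times> real) set"
  assumes "l1 \<noteq> 0" and "l2 \<noteq> 0" and "C \<noteq> 0" and "a \<noteq> 0"
    and "open I" and "is_interval I" and "s0 \<in> I"
    and "smooth_on I \<alpha>" and "smooth_on I z" and "smooth_on I w1" and "smooth_on I w2"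
    and "smooth_on I \<phi>1" and "smooth_on I \<phi>2"
    and "\<forall>s\<in>I. w1 s \<noteq> 0" and "\<forall>s\<in>I. w2 s \<noteq> 0"
    and "\<forall>s\<in>I. r1 s = cmod (w1 s)" and "\<forall>s\<in>I. r2 s = cmod (w2 s)"
    and "\<forall>s\<in>I. w1 s = of_real (r1 s) * exp (\<i> * of_real (\<phi>1 s))"
    and "\<forall>s\<in>I. w2 s = of_real (r2 s) * exp (\<i> * of_real (\<phi>2 s))"
    and "\<forall>s\<in>I. \<phi> s = \<phi>1 s + \<phi>2 s"
    and "\<rho>1 = (r1 s0)\<^sup>2" and "\<rho>2 = (r2 s0)\<^sup>2"
    and "\<forall>s\<in>I. u s = 2 * (LBINT t=s0..s. r1 t * r2 t * cos (\<alpha> t + \<phi> t))"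
    and "\<forall>v. Q v = (\<rho>1 + l1 * v) * (\<rho>2 + l2 * v)"
    and "\<forall>s\<in>I. (w1 has_vector_derivative
                  of_real l1 * exp (- \<i> * of_real (\<alpha> s)) * cnj (w2 s)) (at s)"
    and "\<forall>s\<in>I. (w2 has_vector_derivative
                  of_real l2 * exp (- \<i> * of_real (\<alpha> s)) * cnj (w1 s)) (at s)"
    and "\<forall>s\<in>I. (\<phi>1 has_real_derivative
                  - (l1 / (\<rho>1 + l1 * u s)) * sqrt (Q (u s)) * sin (\<alpha> s + \<phi> s)) (at s)"
    and "\<forall>s\<in>I. (\<phi>2 has_real_derivative
                  - (l2 / (\<rho>2 + l2 * u s)) * sqrt (Q (u s)) * sin (\<alpha> s + \<phi> s)) (at s)"
    and "\<forall>s\<in>I. (z has_real_derivative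
                  C / 2 * sqrt (Q (u s)) * sin (\<alpha> s + \<phi> s)) (at s)"
    and "M = conic_surface I l1 l2 C" and "F = conic_map w1 w2 z"
    and "L = {(of_real x1 * w1 s, of_real x2 * w2 s, z s) | s x1 x2.
                s \<in> I \<and> l1 * x1\<^sup>2 + l2 * x2\<^sup>2 = C}"
  shows "(\<forall>s\<in>I. (r1 s)\<^sup>2 = \<rho>1 + l1 * u s \<and> (r2 s)\<^sup>2 = \<rho>2 + l2 * u s)
    \<and> F ` M = L \<and> legendrian_immersion M F \<and> legendre_angle M F (\<lambda>(s, x1, x2). \<alpha> s)
    \<and> ((\<forall>s\<in>I. (\<alpha> has_real_derivative
                  - (a / 4) * C * r1 s * r2 s * sin (\<alpha> s + \<phi> s)) (at s)) \<longrightarrow>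
         soliton_equation M F (\<lambda>(s, x1, x2). \<alpha> s - (\<alpha> s0 + a / 2 * z s0)) a
       \<and> (\<alpha> s0 + a / 2 * z s0 = 0 \<longrightarrow>
            soliton_equation M F (\<lambda>(s, x1, x2). \<alpha> s) a
          \<and> self_similar_solution M F (\<lambda>(s, x1, x2). \<alpha> s)))"
proof -
  note nonzero = assms(1-4) and sm = assms(8-11) and r = assms(16,17) and polar = assms(18,19)
  note dz = assms(29) and M = assms(30) and F = assms(31) and L = assms(32)
  have e: "exp (- \<i> * of_real t) = cis (- t)" for t
    by (simp only: cis_conv_exp of_real_minus mult_minus_left mult_minus_right)
  have dw: "(w1 has_vector_derivative l1 * cis (- \<alpha> s) * cnj (w2 s)) (at s)"
    "(w2 has_vector_derivative l2 * cis (- \<alpha> s) * cnj (w1 s)) (at s)" if "s \<in> I" for s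
    using assms(25,26) that unfolding e by blast+
  have prod: "cis (\<alpha> s) * w1 s * w2 s = of_real (r1 s * r2 s) * cis (\<alpha> s + \<phi> s)" if "s \<in> I" for s
  proof -
    have w: "w1 s = of_real (r1 s) * cis (\<phi>1 s)" "w2 s = of_real (r2 s) * cis (\<phi>2 s)"
      using polar that unfolding cis_conv_exp by blast+
    have "cis (\<alpha> s) * w1 s * w2 s
        = of_real (r1 s) * of_real (r2 s) * (cis (\<alpha> s) * (cis (\<phi>1 s) * cis (\<phi>2 s)))"
      unfolding w by (simp only: mult_ac)
    then show ?thesis
      using assms(20) that by (simp add: cis_mult)
  qed
  have Re_prod: "Re (cis (\<alpha> s) * w1 s * w2 s) = r1 s * r2 s * cos (\<alpha> s + \<phi> s)"
    and Im_prod: "Im (cis (\<alpha> s) * w1 s * w2 s) = r1 s * r2 s * sin (\<alpha> s + \<phi> s)" if "s \<in> I" for s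
    unfolding prod[OF that] by simp_all
  \<comment> \<open>The endpoints are ordered by \<open>min\<close> and \<open>max\<close> because
    \<open>s\<close> may lie on either side of \<open>s0\<close>.\<close>
  have segment: "{min s0 s..max s0 s} \<subseteq> I" if "s \<in> I" for s
  proof
    fix t assume "t \<in> {min s0 s..max s0 s}"
    then show "t \<in> I"
      using mem_is_interval_1_I[OF assms(6,7) that, of t] mem_is_interval_1_I[OF assms(6) that assms(7), of t]
      by (cases "s0 \<le> s") (simp_all add: min_def max_def)
  qed
  have cont: "continuous_on I (\<lambda>s. r1 s * r2 s * cos (\<alpha> s + \<phi> s))"
  proof -
    have "continuous_on I (\<lambda>s. Re (cis (\<alpha> s) * w1 s * w2 s))"
      using sm by (intro continuous_intros smooth_onD(3))
    then show ?thesis by (rule continuous_on_eq) (rule Re_prod)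
  qed
  \<comment> \<open>Covers both curves, with \<open>v\<close> the partner of \<open>w\<close>.
    Dividing the derivative of the squared modulus by \<open>2 * l\<close> leaves an integrand
    common to both, so the same \<open>u\<close> serves for both radii.\<close>
  have radius: "(cmod (w s))\<^sup>2 = (cmod (w s0))\<^sup>2 + l * u s"
    if s: "s \<in> I" and l: "l \<noteq> 0"
      and w: "\<And>t. t \<in> I \<Longrightarrow> (w has_vector_derivative of_real l * cis (- \<alpha> t) * cnj (v t)) (at t)"
      and wv: "\<And>t. t \<in> I \<Longrightarrow> w t * v t = w1 t * w2 t"
    for w v :: "real \<Rightarrow> complex" and l s
  proof -
    have deriv: "((\<lambda>t. (cmod (w t))\<^sup>2 / (2 * l)) has_vector_derivative r1 t * r2 t * cos (\<alpha> t + \<phi> t)) (at t)"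
      if t: "t \<in> I" for t
    proof -
      let ?d = "of_real l * cis (- \<alpha> t) * cnj (v t)"
      have "((\<lambda>t. w t \<bullet> w t) has_derivative (\<lambda>h. w t \<bullet> (h *\<^sub>R ?d) + (h *\<^sub>R ?d) \<bullet> w t)) (at t)"
        using w[OF t] unfolding has_vector_derivative_def by (intro has_derivative_inner)
      then have "((\<lambda>t. (w t \<bullet> w t) / (2 * l)) has_derivative
          (\<lambda>h. (w t \<bullet> (h *\<^sub>R ?d) + (h *\<^sub>R ?d) \<bullet> w t) / (2 * l))) (at t)"
        by (intro bounded_linear.has_derivative[OF bounded_linear_divide])
      moreover have "(w t \<bullet> (h *\<^sub>R ?d) + (h *\<^sub>R ?d) \<bullet> w t) / (2 * l)
          = h * (r1 t * r2 t * cos (\<alpha> t + \<phi> t))" for h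
      proof -
        have "(w t \<bullet> (h *\<^sub>R ?d) + (h *\<^sub>R ?d) \<bullet> w t) / (2 * l) = h * (w t \<bullet> ?d) / l"
          by (simp add: inner_commute[of ?d])
        also have "w t \<bullet> ?d = l * Re (cis (\<alpha> t) * (w t * v t))"
          by (simp add: inner_complex_def algebra_simps)
        also have "Re (cis (\<alpha> t) * (w t * v t)) = r1 t * r2 t * cos (\<alpha> t + \<phi> t)"
          using Re_prod[OF t] wv[OF t] by (simp only: mult.assoc)
        finally show ?thesis using l by simp
      qed
      ultimately show ?thesis
        by (simp add: has_vector_derivative_def dot_square_norm)
    qed
    have "(LBINT t=s0..s. r1 t * r2 t * cos (\<alpha> t + \<phi> t))
        = (cmod (w s))\<^sup>2 / (2 * l) - (cmod (w s0))\<^sup>2 / (2 * l)"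
    proof (rule interval_integral_FTC_finite)
      show "continuous_on {min s0 s..max s0 s} (\<lambda>t. r1 t * r2 t * cos (\<alpha> t + \<phi> t))"
        by (rule continuous_on_subset[OF cont segment[OF s]])
      show "((\<lambda>t. (cmod (w t))\<^sup>2 / (2 * l)) has_vector_derivative r1 t * r2 t * cos (\<alpha> t + \<phi> t))
          (at t within {min s0 s..max s0 s})" if "min s0 s \<le> t" "t \<le> max s0 s" for t
        using segment[OF s] that by (intro has_vector_derivative_at_within[OF deriv]) auto
    qed
    then show ?thesis
      using assms(23) s l by (simp add: field_simps)
  qed
  have radii: "(r1 s)\<^sup>2 = \<rho>1 + l1 * u s" "(r2 s)\<^sup>2 = \<rho>2 + l2 * u s" if s: "s \<in> I" for s
    using radius[OF s nonzero(1) dw(1)] radius[OF s nonzero(2) dw(2)] r s assms(7,21,22)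
    by (simp_all add: mult.commute[of "w2 _"])
  have sqrtQ: "sqrt (Q (u s)) = r1 s * r2 s" if s: "s \<in> I" for s
  proof -
    have "Q (u s) = (r1 s * r2 s)\<^sup>2"
      using assms(24) radii[OF s] by (simp add: power_mult_distrib)
    then show ?thesis using r s by simp
  qed
  interpret conic_curve l1 l2 C I \<alpha> z w1 w2
  proof
    show "(z has_real_derivative C / 2 * Im (cis (\<alpha> s) * w1 s * w2 s)) (at s)" if "s \<in> I" for s
      using dz[rule_format, OF that] unfolding sqrtQ[OF that] Im_prod[OF that] by (simp add: mult.assoc)
  qed (use assms(1-3,5,14,15) sm dw in blast)+
  have image: "F ` M = L"
    unfolding M F L by (force simp: conic_surface_def conic_map_def image_iff)
  \<comment> \<open>The shift is the conserved value of \<open>\<alpha> + a / 2 * z\<close>.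
    Translating \<open>z\<close> preserves the system and, as \<open>a\<close> is nonzero, can bring
    this value to zero.\<close>
  have soliton: "soliton_equation M F (\<lambda>(s, x1, x2). \<alpha> s - (\<alpha> s0 + a / 2 * z s0)) a"
    if d\<alpha>: "\<forall>s\<in>I. (\<alpha> has_real_derivative - (a / 4) * C * r1 s * r2 s * sin (\<alpha> s + \<phi> s)) (at s)"
  proof -
    have "((\<lambda>s. \<alpha> s + a / 2 * z s) has_field_derivative 0) (at s within I)" if s: "s \<in> I" for s
    proof -
      have "((\<lambda>s. \<alpha> s + a / 2 * z s) has_real_derivative
          - (a / 4) * C * r1 s * r2 s * sin (\<alpha> s + \<phi> s) + a / 2 * (C / 2 * sqrt (Q (u s)) * sin (\<alpha> s + \<phi> s)))
          (at s)"
        using d\<alpha> dz s by (intro DERIV_add DERIV_cmult) auto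
      then show ?thesis
        by (simp add: sqrtQ[OF s] has_field_derivative_at_within)
    qed
    then obtain c where "\<And>s. s \<in> I \<Longrightarrow> \<alpha> s + a / 2 * z s = c"
      using has_field_derivative_zero_constant[of I "\<lambda>s. \<alpha> s + a / 2 * z s"] is_interval_convex[OF assms(6)]
      by blast
    then show ?thesis
      unfolding M F using assms(7) by (intro soliton_equation_F) auto
  qed
  \<comment> \<open>The sign of the nonzero \<open>a\<close> decides between shrinker and
    expander.\<close>
  have "self_similar_solution M F \<beta>"
    if "legendrian_immersion M F" "legendre_angle M F \<beta>" "soliton_equation M F \<beta> a" for \<beta>
    using that assms(4) unfolding self_similar_solution_def self_shrinker_def self_expander_def
    by (meson linorder_neqE_linordered_idom)
  then show ?thesis
    using radii image soliton legendrian_immersion_F legendre_angle_F by (auto simp: M F)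
qed

end
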